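(* The problem $\chi$-$\textsc{Unfrozenness}$ is in $\mathrm{P}$ for co-graphs; that is, there is a deterministic polynomial-time algorithm that, given any co-graph $G$, decides whether $G$ is $\chi$-unfrozen.
   Context: Graphs are finite, undirected, simple, without loops. Co-graphs are defined recursively: a single-vertex graph $(\{v\},\emptyset)$ is a co-graph; if $G_1$ and $G_2$ are (vertex-disjoint) co-graphs, then so are their disjoint union $G_1\cup G_2$ and their join $G_1+G_2$ (the disjoint union together with all edges between $V(G_1)$ and $V(G_2)$). $\chi(G)$ is the chromatic number. A nonedge of $G$ is a pair $e=\{u,v\}$ of distinct vertices with $e\notin E(G)$; for a nonedge $e$, $G+e$ is $G$ with $e$ added as an edge. $G$ is $\chi$-unfrozen if $\chi(G+e)=\chi(G)$ for every nonedge $e$ of $G$; $\chi$-$\textsc{Unfrozenness}$ is the set of $\chi$-unfrozen graphs. Running time is polynomial in the size of the encoding of $G$. *)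

theory Defs
  imports Main "HOL-Computational_Algebra.Polynomial"
begin

type_synonym 'a graph = "'a set \<times> 'a set set"

abbreviation vertices :: "'a graph \<Rightarrow> 'a set" where
  "vertices \<equiv> fst"

abbreviation edges :: "'a graph \<Rightarrow> 'a set set" where
  "edges \<equiv> snd"

definition simple_graph :: "'a graph \<Rightarrow> bool" where
  "simple_graph G \<longleftrightarrow>
     finite (vertices G) \<and> (\<forall>e\<in>edges G. e \<subseteq> vertices G \<and> card e = 2)"

definition graph_union :: "'a graph \<Rightarrow> 'a graph \<Rightarrow> 'a graph" where
  "graph_union G H = (vertices G \<union> vertices H, edges G \<union> edges H)"

definition graph_join :: "'a graph \<Rightarrow> 'a graph \<Rightarrow> 'a graph" where
  "graph_join G H =
     (vertices G \<union> vertices H,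
      edges G \<union> edges H \<union> {{u, v} | u v. u \<in> vertices G \<and> v \<in> vertices H})"

inductive cograph :: "'a graph \<Rightarrow> bool" where
  cograph_single: "cograph ({v}, {})"
| cograph_union:
    "cograph G \<Longrightarrow> cograph H \<Longrightarrow> vertices G \<inter> vertices H = {} \<Longrightarrow> cograph (graph_union G H)"
| cograph_join:
    "cograph G \<Longrightarrow> cograph H \<Longrightarrow> vertices G \<inter> vertices H = {} \<Longrightarrow> cograph (graph_join G H)"

lemma cograph_simple_graph: "cograph G \<Longrightarrow> simple_graph G"
proof (induction rule: cograph.induct)
  case (cograph_single v)
  then show ?case by (simp add: simple_graph_def)
next
  case (cograph_union G H)
  then show ?case by (auto simp: simple_graph_def graph_union_def)
next
  case (cograph_join G H)
  then have "card {u, v} = 2" if "u \<in> vertices G" "v \<in> vertices H" for u v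
    using that by (metis card_2_iff disjoint_iff)
  with cograph_join show ?case
    by (fastforce simp: simple_graph_def graph_join_def)
qed

definition proper_coloring :: "'a graph \<Rightarrow> nat \<Rightarrow> ('a \<Rightarrow> nat) \<Rightarrow> bool" where
  "proper_coloring G k c \<longleftrightarrow>
     c ` vertices G \<subseteq> {..<k} \<and> (\<forall>u v. {u, v} \<in> edges G \<longrightarrow> c u \<noteq> c v)"

definition chromatic_number :: "'a graph \<Rightarrow> nat" where
  "chromatic_number G = (LEAST k. \<exists>c. proper_coloring G k c)"

definition nonedges :: "'a graph \<Rightarrow> 'a set set" where
  "nonedges G =
     {{u, v} | u v. u \<in> vertices G \<and> v \<in> vertices G \<and> u \<noteq> v \<and> {u, v} \<notin> edges G}"

definition add_edge :: "'a graph \<Rightarrow> 'a set \<Rightarrow> 'a graph" where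
  "add_edge G e = (vertices G, insert e (edges G))"

definition chi_unfrozen :: "'a graph \<Rightarrow> bool" where
  "chi_unfrozen G \<longleftrightarrow>
     (\<forall>e\<in>nonedges G. chromatic_number (add_edge G e) = chromatic_number G)"

definition chi_Unfrozenness :: "'a graph set" where
  "chi_Unfrozenness = {G. simple_graph G \<and> chi_unfrozen G}"

datatype move = Move_Left | Stay | Move_Right

text \<open>
  States and tape symbols are initial segments of the natural numbers. Symbol 0 is the
  blank, 1 and 2 are the input bits; further symbols may be used as work symbols.
\<close>

record tm =
  num_tapes :: nat
  num_symbols :: nat
  num_states :: nat
  start_state :: nat
  accept_state :: nat
  reject_state :: nat
  transition :: "nat \<Rightarrow> nat list \<Rightarrow> nat \<times> (nat \<times> move) list"

definition halting_states :: "tm \<Rightarrow> nat set" where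
  "halting_states M = {accept_state M, reject_state M}"

definition wf_tm :: "tm \<Rightarrow> bool" where
  "wf_tm M \<longleftrightarrow>
     num_tapes M \<ge> 1 \<and> num_symbols M \<ge> 3 \<and>
     start_state M < num_states M \<and> accept_state M < num_states M \<and>
     reject_state M < num_states M \<and> accept_state M \<noteq> reject_state M \<and>
     (\<forall>q ss. q < num_states M \<longrightarrow> q \<notin> halting_states M \<longrightarrow>
        length ss = num_tapes M \<longrightarrow> set ss \<subseteq> {..<num_symbols M} \<longrightarrow>
        (case transition M q ss of (q', acts) \<Rightarrow>
           q' < num_states M \<and> length acts = num_tapes M \<and>
           (\<forall>(s, m)\<in>set acts. s < num_symbols M)))"

text \<open>A tape is infinite in both directions and comes with its head position.\<close>

type_synonym tape = "(int \<Rightarrow> nat) \<times> int"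

type_synonym config = "nat \<times> tape list"

definition read_tape :: "tape \<Rightarrow> nat" where
  "read_tape t = fst t (snd t)"

fun head_offset :: "move \<Rightarrow> int" where
  "head_offset Move_Left = - 1"
| "head_offset Stay = 0"
| "head_offset Move_Right = 1"

definition act_tape :: "nat \<times> move \<Rightarrow> tape \<Rightarrow> tape" where
  "act_tape a t = ((fst t)(snd t := fst a), snd t + head_offset (snd a))"

definition step :: "tm \<Rightarrow> config \<Rightarrow> config" where
  "step M c =
     (if fst c \<in> halting_states M then c
      else case transition M (fst c) (map read_tape (snd c)) of
        (q', acts) \<Rightarrow> (q', map2 act_tape acts (snd c)))"

definition input_tape :: "bool list \<Rightarrow> tape" where
  "input_tape x =
     ((\<lambda>i. if 0 \<le> i \<and> i < int (length x) then (if x ! nat i then 2 else 1) else 0), 0)"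

definition blank_tape :: tape where
  "blank_tape = ((\<lambda>_. 0), 0)"

definition initial_config :: "tm \<Rightarrow> bool list \<Rightarrow> config" where
  "initial_config M x =
     (start_state M, input_tape x # replicate (num_tapes M - 1) blank_tape)"

definition config_at :: "tm \<Rightarrow> bool list \<Rightarrow> nat \<Rightarrow> config" where
  "config_at M x t = (step M ^^ t) (initial_config M x)"

definition accepts :: "tm \<Rightarrow> bool list \<Rightarrow> bool" where
  "accepts M x \<longleftrightarrow> (\<exists>t. fst (config_at M x t) = accept_state M)"

definition polynomial_time :: "tm \<Rightarrow> bool" where
  "polynomial_time M \<longleftrightarrow>
     (\<exists>p :: nat poly. \<forall>x. fst (config_at M x (poly p (length x))) \<in> halting_states M)"

text \<open>
  The number of vertices in unary, a separating zero, and then the rows of the adjacency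
  matrix with respect to the enumeration \<open>vs\<close> of the vertices.
\<close>

definition encode_graph :: "'a list \<Rightarrow> 'a graph \<Rightarrow> bool list" where
  "encode_graph vs G =
     replicate (length vs) True @ [False] @
     concat (map (\<lambda>u. map (\<lambda>v. {u, v} \<in> edges G) vs) vs)"

text \<open>
  The machine has to halt in polynomial time on every input string. It has to give the
  correct answer for all graphs in the class, however their vertices are enumerated; its
  answers on other inputs are irrelevant. Natural numbers as vertices are no restriction,
  since the encoding depends only on the isomorphism type and the enumeration.
\<close>

definition in_P_for :: "nat graph set \<Rightarrow> nat graph set \<Rightarrow> bool" where
  "in_P_for problem graph_class \<longleftrightarrow>
     (\<exists>M. wf_tm M \<and> polynomial_time M \<and>
        (\<forall>G vs. G \<in> graph_class \<longrightarrow> distinct vs \<longrightarrow> set vs = vertices G \<longrightarrow>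
           (accepts M (encode_graph vs G) \<longleftrightarrow> G \<in> problem)))"

end

theory Submission
  imports Defs "HOL-Library.Countable"
begin

text \<open>
  In a co-graph, adding a nonedge \<open>uv\<close> raises the chromatic number iff \<open>u\<close> and \<open>v\<close> have the same
  neighbours and \<open>u\<close> lies in a maximum clique: a union with both vertices on different sides allows
  the colours of one side to be permuted, unless there is only one colour. To test whether \<open>u\<close> lies in a
  maximum clique, maximal independent sets are peeled off, neighbours of \<open>u\<close> first, until \<open>u\<close> is
  gone; it does iff nothing remains. This works because the peeled sets are the colour classes of a Grundy
  colouring, and a Grundy colouring of a co-graph uses as many colours as some clique through
  a vertex of the last colour has vertices.

  The algorithm only sweeps over the adjacency matrix row by row with a finite memory and finitely
  many flags per vertex, inside loops over the vertices. Such programs are compiled to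
  multi-tape machines with one unary counter tape per loop depth.
\<close>

section \<open>Structured tape programs\<close>

text \<open>The usual algorithms for co-graphs recurse along a cotree, which a machine with finite
  control would first have to compute and then traverse with a stack. The criterion by twins and
  maximum cliques mentions no cotree: recursion over the structure of the co-graph survives only in
  the proofs, while the procedure sees nothing but rows of the matrix. The order of peeling is
  forced by the fact that a Grundy colouring promises a clique only through a vertex of the last
  colour. If some vertex outlives \<open>u\<close>, it completes a clique with one vertex more than
  there were rounds; the neighbours of \<open>u\<close>, being preferred, were all peeled before
  \<open>u\<close>, so no clique through \<open>u\<close> has more vertices than there were rounds.
  The machine must halt in polynomial time also on strings that encode no graph. Hence loops of scan
  programs are bounded by counters filled from the leading ones of the input, and the time bound is
  read off from the program text, never from properties of a graph.\<close>

datatype prog =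
    Act "nat list \<Rightarrow> (nat \<times> move) list"
  | Seq prog prog
  | While "nat list \<Rightarrow> bool" prog

definition keep :: "nat list \<Rightarrow> (nat \<times> move) list" where
  "keep ss = map (\<lambda>s. (s, Stay)) ss"

definition apply_acts :: "(nat list \<Rightarrow> (nat \<times> move) list) \<Rightarrow> tape list \<Rightarrow> tape list" where
  "apply_acts f ts = map2 act_tape (f (map read_tape ts)) ts"

text \<open>Steps are counted exactly as the machine makes them: an action is one transition, a loop
  test is one, and each round of a loop adds one more for the jump back to the test.\<close>

inductive exec :: "prog \<Rightarrow> nat \<Rightarrow> tape list \<Rightarrow> tape list \<Rightarrow> bool" where
  exec_Act: "exec (Act f) 1 ts (apply_acts f ts)"
| exec_Seq: "exec p a ts ts' \<Longrightarrow> exec q b ts' ts'' \<Longrightarrow> exec (Seq p q) (a + b) ts ts''"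
| exec_While_False: "\<not> b (map read_tape ts) \<Longrightarrow> exec (While b p) 1 ts ts"
| exec_While_True: "b (map read_tape ts) \<Longrightarrow> exec p a ts ts' \<Longrightarrow> exec (While b p) c ts' ts'' \<Longrightarrow>
    exec (While b p) (Suc (a + Suc c)) ts ts''"

fun code_length :: "prog \<Rightarrow> nat" where
  "code_length (Act f) = 1"
| "code_length (Seq p q) = code_length p + code_length q"
| "code_length (While b p) = code_length p + 2"

text \<open>Addresses are absolute: entry \<open>i\<close> of the list is the transition of state
  \<open>a + i\<close>. Every fragment leaves through the first address behind it, so sequencing is
  concatenation.\<close>

fun code :: "prog \<Rightarrow> nat \<Rightarrow> (nat list \<Rightarrow> nat \<times> (nat \<times> move) list) list" where
  "code (Act f) a = [\<lambda>ss. (Suc a, f ss)]"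
| "code (Seq p q) a = code p a @ code q (a + code_length p)"
| "code (While b p) a =
    (\<lambda>ss. (if b ss then Suc a else a + code_length p + 2, keep ss)) #
    code p (Suc a) @ [\<lambda>ss. (a, keep ss)]"

lemma length_code [simp]: "length (code p a) = code_length p"
  by (induction p arbitrary: a) auto

text \<open>The address behind the program, \<open>code_length p\<close>, is one more working state:
  it turns the symbols under the heads into a verdict by \<open>acc\<close>.\<close>

definition machine :: "nat \<Rightarrow> nat \<Rightarrow> prog \<Rightarrow> (nat list \<Rightarrow> bool) \<Rightarrow> tm" where
  "machine k K p acc =
    \<lparr>num_tapes = k, num_symbols = K, num_states = code_length p + 3, start_state = 0,
     accept_state = code_length p + 1, reject_state = code_length p + 2,
     transition = (\<lambda>q ss. if q < code_length p then (code p 0 ! q) ss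
       else (if acc ss then code_length p + 1 else code_length p + 2, keep ss))\<rparr>"

fun wf_prog :: "nat \<Rightarrow> nat \<Rightarrow> prog \<Rightarrow> bool" where
  "wf_prog k K (Act f) \<longleftrightarrow>
    (\<forall>ss. length ss = k \<longrightarrow> set ss \<subseteq> {..<K} \<longrightarrow> length (f ss) = k \<and> fst ` set (f ss) \<subseteq> {..<K})"
| "wf_prog k K (Seq p q) \<longleftrightarrow> wf_prog k K p \<and> wf_prog k K q"
| "wf_prog k K (While b p) \<longleftrightarrow> wf_prog k K p"

lemma wf_code:
  assumes "wf_prog k K p" "g \<in> set (code p a)" "length ss = k" "set ss \<subseteq> {..<K}"
  shows "fst (g ss) \<le> a + code_length p \<and> length (snd (g ss)) = k \<and> fst ` set (snd (g ss)) \<subseteq> {..<K}"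
  using assms
proof (induction p arbitrary: a)
  case (Seq p q)
  then show ?case by fastforce
next
  case (While b p)
  then show ?case by (fastforce simp: keep_def)
qed auto

lemma wf_machine:
  assumes "wf_prog k K p" "k \<ge> 1" "K \<ge> 3"
  shows "wf_tm (machine k K p acc)"
proof -
  have "case (code p 0 ! q) ss of (q', acts) \<Rightarrow>
           q' < code_length p + 3 \<and> length acts = k \<and> (\<forall>(s, m)\<in>set acts. s < K)"
    if "q < code_length p" "length ss = k" "set ss \<subseteq> {..<K}" for q ss
    using wf_code[OF assms(1), of "code p 0 ! q" 0 ss] that
    by (fastforce split: prod.splits)
  then show ?thesis
    using assms(2,3) by (auto simp: wf_tm_def machine_def keep_def halting_states_def)
qed

lemma apply_acts_keep: "map2 act_tape (keep (map read_tape ts)) ts = ts"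
  by (induction ts) (auto simp: keep_def act_tape_def read_tape_def)

lemma step_unfold:
  assumes "q \<notin> halting_states M"
  shows "step M (q, ts) = (fst (transition M q (map read_tape ts)),
      map2 act_tape (snd (transition M q (map read_tape ts))) ts)"
  using assms by (simp add: step_def split: prod.splits)

text \<open>That the fragment sits at address \<open>a\<close> of \<open>M\<close> is a hypothesis,
  which the induction passes on to subprograms at other addresses of the same machine.\<close>

lemma step_code:
  assumes "exec p t ts ts'"
    and "\<And>i. i < code_length p \<Longrightarrow> transition M (a + i) = code p a ! i"
    and "\<And>i. i < code_length p \<Longrightarrow> a + i \<notin> halting_states M"
  shows "(step M ^^ t) (a, ts) = (a + code_length p, ts')"
  using assms
proof (induction arbitrary: a rule: exec.induct)
  case (exec_Act f ts)
  then show ?case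
    using exec_Act(1)[of 0] exec_Act(2)[of 0] by (simp add: step_unfold apply_acts_def)
next
  case (exec_Seq p s ts ts' q t ts'')
  have 1: "(step M ^^ s) (a, ts) = (a + code_length p, ts')"
  proof (rule exec_Seq.IH)
    fix i assume i: "i < code_length p"
    show "transition M (a + i) = code p a ! i"
      using i exec_Seq.prems(1)[of i] by (simp add: nth_append)
    show "a + i \<notin> halting_states M"
      using i exec_Seq.prems(2)[of i] by simp
  qed
  have 2: "(step M ^^ t) (a + code_length p, ts') = (a + code_length p + code_length q, ts'')"
  proof (rule exec_Seq.IH)
    fix i assume i: "i < code_length q"
    show "transition M (a + code_length p + i) = code q (a + code_length p) ! i"
      using i exec_Seq.prems(1)[of "code_length p + i"] by (simp add: nth_append add.assoc)
    show "a + code_length p + i \<notin> halting_states M"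
      using i exec_Seq.prems(2)[of "code_length p + i"] by (simp add: add.assoc)
  qed
  show ?case using 1 2 by (simp add: add.commute[of s t] funpow_add add.assoc)
next
  case (exec_While_False b ts p)
  then show ?case
    using exec_While_False.prems(1)[of 0] exec_While_False.prems(2)[of 0]
    by (simp add: step_unfold apply_acts_keep)
next
  case (exec_While_True b ts p s ts' t ts'')
  have 1: "step M (a, ts) = (Suc a, ts)"
    using exec_While_True.prems(1)[of 0] exec_While_True.prems(2)[of 0] exec_While_True.hyps(1)
    by (simp add: step_unfold apply_acts_keep)
  have 2: "(step M ^^ s) (Suc a, ts) = (Suc a + code_length p, ts')"
  proof (rule exec_While_True.IH)
    fix i assume i: "i < code_length p"
    show "transition M (Suc a + i) = code p (Suc a) ! i"
      using i exec_While_True.prems(1)[of "Suc i"] by (simp add: nth_append)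
    show "Suc a + i \<notin> halting_states M"
      using i exec_While_True.prems(2)[of "Suc i"] by simp
  qed
  have 3: "step M (Suc a + code_length p, ts') = (a, ts')"
    using exec_While_True.prems(1)[of "Suc (code_length p)"]
      exec_While_True.prems(2)[of "Suc (code_length p)"]
    by (simp add: step_unfold apply_acts_keep nth_append)
  have 4: "(step M ^^ t) (a, ts') = (a + code_length (While b p), ts'')"
    by (rule exec_While_True.IH) (use exec_While_True.prems in auto)
  have "(step M ^^ Suc (s + Suc t)) (a, ts) = (step M ^^ (t + Suc s)) (step M (a, ts))"
    by (simp add: funpow_swap1 add.commute)
  also have "\<dots> = (step M ^^ t) (step M ((step M ^^ s) (Suc a, ts)))"
    unfolding 1 by (simp add: funpow_add funpow_swap1)
  also have "\<dots> = (a + code_length (While b p), ts'')"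
    unfolding 2 3 4 by simp
  finally show ?case .
qed

lemma halting_stays:
  assumes "fst c \<in> halting_states M"
  shows "(step M ^^ t) c = c"
proof -
  have "step M c = c" using assms by (simp add: step_def)
  then show ?thesis by (induction t) auto
qed

lemma machine_halts:
  assumes "exec p t (snd (initial_config (machine k K p acc) x)) ts"
  shows "fst (config_at (machine k K p acc) x (Suc t)) =
    (if acc (map read_tape ts) then code_length p + 1 else code_length p + 2)"
proof -
  define M where "M = machine k K p acc"
  have "(step M ^^ t) (0, snd (initial_config M x)) = (0 + code_length p, ts)"
    by (rule step_code) (use assms in \<open>auto simp: M_def machine_def halting_states_def\<close>)
  moreover have "fst (initial_config M x) = 0"
    by (simp add: initial_config_def M_def machine_def)
  ultimately have "(step M ^^ t) (initial_config M x) = (code_length p, ts)"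
    by (metis add_0 prod.collapse)
  moreover have "code_length p \<notin> halting_states M"
    by (simp add: M_def machine_def halting_states_def)
  ultimately show ?thesis
    unfolding M_def[symmetric] config_at_def
    by (simp add: step_unfold) (simp add: M_def machine_def)
qed

text \<open>Halting configurations are fixed points of \<open>step\<close>, so any halting time
  agrees with the time that witnesses acceptance.\<close>

lemma accepts_iff_halting:
  assumes "wf_tm M" "fst (config_at M x t) \<in> halting_states M"
  shows "accepts M x \<longleftrightarrow> fst (config_at M x t) = accept_state M"
proof
  assume "accepts M x"
  then obtain s where s: "fst (config_at M x s) = accept_state M" by (auto simp: accepts_def)
  have "config_at M x (s + t) = config_at M x s"
    using halting_stays[of "config_at M x s" M t] s
    by (simp add: config_at_def halting_states_def add.commute[of s t] funpow_add)
  moreover have "config_at M x (s + t) = config_at M x t"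
    using halting_stays[of "config_at M x t" M s] assms(2)
    by (simp add: config_at_def funpow_add)
  ultimately show "fst (config_at M x t) = accept_state M" using s by simp
qed (auto simp: accepts_def)

lemma halting_mono:
  assumes "fst (config_at M x s) \<in> halting_states M" "s \<le> t"
  shows "config_at M x t = config_at M x s"
proof -
  have "config_at M x ((t - s) + s) = config_at M x s"
    using halting_stays[of "config_at M x s" M "t - s"] assms(1)
    by (simp add: config_at_def funpow_add)
  then show ?thesis using assms(2) by simp
qed

section \<open>Scan programs\<close>

text \<open>
  A scan program works on a memory of type \<open>'m\<close>, a row of \<open>n\<close> cells of type \<open>'c\<close> and an input position,
  where \<open>n\<close> is the number of leading ones of the input. \<open>Pass b f\<close> runs a finite transducer over
  the cells and moves along the input iff \<open>b\<close>; \<open>For\<close> iterates its body \<open>n\<close> times.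
  Both types are finite in the end, so running times are polynomial by construction.
\<close>

datatype ('m, 'c) hl =
    Upd "'m \<Rightarrow> 'm"
  | Pass bool "'m \<Rightarrow> 'c \<Rightarrow> bool \<Rightarrow> 'm \<times> 'c"
  | Rewind
  | Then "('m, 'c) hl" "('m, 'c) hl"  (infixr ";;" 60)
  | For "('m, 'c) hl"

type_synonym ('m, 'c) hstate = "'m \<times> (nat \<Rightarrow> 'c) \<times> nat"

definition pass_step ::
  "(nat \<Rightarrow> bool) \<Rightarrow> bool \<Rightarrow> ('m \<Rightarrow> 'c \<Rightarrow> bool \<Rightarrow> 'm \<times> 'c) \<Rightarrow> nat \<Rightarrow> nat \<Rightarrow> 'm \<times> (nat \<Rightarrow> 'c) \<Rightarrow> 'm \<times> (nat \<Rightarrow> 'c)" where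
  "pass_step inp b f p i = (\<lambda>(m, d).
     let (m', c) = f m (d i) (inp (if b then p + i else p)) in (m', d(i := c)))"

primrec hexec :: "nat \<Rightarrow> (nat \<Rightarrow> bool) \<Rightarrow> ('m, 'c) hl \<Rightarrow> ('m, 'c) hstate \<Rightarrow> ('m, 'c) hstate" where
  "hexec n inp (Upd g) = (\<lambda>(m, d, p). (g m, d, p))"
| "hexec n inp (Pass b f) = (\<lambda>(m, d, p).
     let (m', d') = fold (pass_step inp b f p) [0..<n] (m, d) in (m', d', if b then p + n else p))"
| "hexec n inp Rewind = (\<lambda>(m, d, p). (m, d, 0))"
| "hexec n inp (P ;; Q) = (\<lambda>s. hexec n inp Q (hexec n inp P s))"
| "hexec n inp (For P) = hexec n inp P ^^ n"

text \<open>Loops of the same depth are never nested, so they can share one counter tape, provided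
  that each of them hands it back rewound.\<close>

primrec depth :: "('m, 'c) hl \<Rightarrow> nat" where
  "depth (Upd g) = 0"
| "depth (Pass b f) = 0"
| "depth Rewind = 0"
| "depth (P ;; Q) = max (depth P) (depth Q)"
| "depth (For P) = Suc (depth P)"

section \<open>Compilation of scan programs to tape programs\<close>

definition enc_cell :: "'c::countable \<Rightarrow> nat" where "enc_cell c = Suc (to_nat c)"
definition dec_cell :: "nat \<Rightarrow> 'c::countable" where "dec_cell s = from_nat (s - 1)"

text \<open>Codes of cells are shifted by one to keep them apart from the blank, by which a pass
  recognises the end of the row.\<close>

lemma dec_enc_cell [simp]: "dec_cell (enc_cell c) = c" and enc_cell_pos [simp]: "enc_cell c > 0"
  by (auto simp: enc_cell_def dec_cell_def)

definition move_head :: "nat \<Rightarrow> move \<Rightarrow> nat list \<Rightarrow> (nat \<times> move) list" where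
  "move_head j d ss = (keep ss)[j := (ss ! j, d)]"

text \<open>The head may stand on the blank behind its block, where the loop would stop at once;
  hence the unconditional first move.\<close>

definition rewind :: "nat \<Rightarrow> prog" where
  "rewind j = Seq (Act (move_head j Move_Left))
     (Seq (While (\<lambda>ss. ss ! j \<noteq> 0) (Act (move_head j Move_Left))) (Act (move_head j Move_Right)))"

text \<open>The memory is a single symbol, so one transition performs a whole transducer step. Every
  input symbol other than 2, the blank beyond the input included, counts as the bit False.\<close>

definition pass_acts ::
  "bool \<Rightarrow> ('m::countable \<Rightarrow> 'c::countable \<Rightarrow> bool \<Rightarrow> 'm \<times> 'c) \<Rightarrow> nat list \<Rightarrow> (nat \<times> move) list" where
  "pass_acts b f ss =
    (case f (from_nat (ss ! 2)) (dec_cell (ss ! 1)) (ss ! 0 = 2) of (m, c) \<Rightarrow>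
      (keep ss)[0 := (ss ! 0, if b then Move_Right else Stay),
        1 := (enc_cell c, Move_Right), 2 := (to_nat m, Stay)])"

primrec compile :: "('m::countable, 'c::countable) hl \<Rightarrow> prog" where
  "compile (Upd g) = Act (\<lambda>ss. (keep ss)[2 := (to_nat (g (from_nat (ss ! 2))), Stay)])"
| "compile (Pass b f) = Seq
     (While (\<lambda>ss. ss ! 1 \<noteq> 0) (Act (pass_acts b f)))
     (rewind 1)"
| "compile Rewind = Seq (While (\<lambda>ss. ss ! 0 \<noteq> 3) (Act (move_head 0 Move_Left)))
     (Act (move_head 0 Move_Right))"
| "compile (P ;; Q) = Seq (compile P) (compile Q)"
| "compile (For P) = Seq
     (While (\<lambda>ss. ss ! (3 + depth P) \<noteq> 0)
       (Seq (compile P) (Act (move_head (3 + depth P) Move_Right))))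
     (rewind (3 + depth P))"

text \<open>
  Tape 0 holds the input, tape 1 the cells, tape 2 the memory as one symbol, and tape \<open>3 + l\<close> the loop
  counter of nesting depth \<open>l\<close>, namely \<open>n\<close> marks with the head at \<open>hs l\<close>. The separator of the input, at
  position \<open>n\<close>, is overwritten by 3, so that \<open>Rewind\<close> finds the beginning of the matrix
  even if the input is malformed and the head has run past its end.
\<close>

definition segment :: "nat \<Rightarrow> (nat \<Rightarrow> nat) \<Rightarrow> int \<Rightarrow> nat" where
  "segment n f j = (if 0 \<le> j \<and> j < int n then f (nat j) else 0)"

lemma segment_at [simp]:
  "segment n f (- 1) = 0" "segment n f (int n) = 0" "i < n \<Longrightarrow> segment n f (int i) = f i"
  by (auto simp: segment_def)

lemma segment_upd: "i < n \<Longrightarrow> (segment n f)(int i := s) = segment n (f(i := s))"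
  by (auto simp: segment_def fun_eq_iff)

lemma segment_extend: "(segment n f)(int n := s) = segment (Suc n) (f(n := s))"
  by (auto simp: segment_def fun_eq_iff)

lemma segment_cong: "(\<And>i. i < n \<Longrightarrow> f i = g i) \<Longrightarrow> segment n f = segment n g"
  by (auto simp: segment_def fun_eq_iff)

definition counters :: "nat \<Rightarrow> nat \<Rightarrow> (nat \<Rightarrow> nat) \<Rightarrow> tape list" where
  "counters n L hs = map (\<lambda>i. (segment n (\<lambda>_. 1), int (hs i))) [0..<L]"

fun rep :: "(int \<Rightarrow> nat) \<Rightarrow> nat \<Rightarrow> nat \<Rightarrow> (nat \<Rightarrow> nat) \<Rightarrow> ('m::countable, 'c::countable) hstate \<Rightarrow> tape list" where
  "rep Z n L hs (m, d, p) =
     (Z, int n + 1 + int p) # (segment n (enc_cell \<circ> d), 0) # ((\<lambda>_. 0)(0 := to_nat m), 0) # counters n L hs"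

lemma act_tape_Pair: "act_tape (s, d) (g, h) = (g(h := s), h + head_offset d)"
  by (simp add: act_tape_def)

lemma keep_Cons: "keep (s # ss) = (s, Stay) # keep ss"
  by (simp add: keep_def)

lemma keep_update:
  "map2 act_tape (as[j := a]) ts = (map2 act_tape as ts)[j := act_tape a (ts ! j)]"
  if "j < length ts"
  using that
proof (induction as arbitrary: j ts)
  case (Cons x as)
  then show ?case by (cases ts; cases j) auto
qed simp

lemma apply_move_head:
  assumes "j < length ts"
  shows "apply_acts (move_head j d) ts = ts[j := (fst (ts ! j), snd (ts ! j) + head_offset d)]"
  using assms
  by (cases "ts ! j")
    (simp add: apply_acts_def move_head_def keep_update apply_acts_keep act_tape_Pair read_tape_def)

text \<open>Each of the \<open>h\<close> rounds takes three steps: test, move, jump back. The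
  failing test and the two outer moves are the other three.\<close>

lemma exec_rewind:
  assumes j: "j < length ts" and t: "ts ! j = (g, int h)"
    and g: "\<And>i. 0 \<le> i \<Longrightarrow> i < int h \<Longrightarrow> g i \<noteq> 0" "g (- 1) = 0"
  shows "exec (rewind j) (3 * h + 3) ts (ts[j := (g, 0)])"
proof -
  have loop: "exec (While (\<lambda>ss. ss ! j \<noteq> 0) (Act (move_head j Move_Left)))
      (3 * i + 1) (ts[j := (g, int i - 1)]) (ts[j := (g, - 1)])" if "i \<le> h" for i
    using that
  proof (induction i)
    case 0
    show ?case
      using j g(2) exec_While_False[of "\<lambda>ss. ss ! j \<noteq> 0" "ts[j := (g, - 1)]"]
      by (simp add: read_tape_def)
  next
    case (Suc i)
    have "exec (Act (move_head j Move_Left)) 1 (ts[j := (g, int i)]) (ts[j := (g, int i - 1)])"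
      using exec_Act[of "move_head j Move_Left" "ts[j := (g, int i)]"] j by (simp add: apply_move_head)
    from exec_While_True[OF _ this Suc.IH] show ?case
      using j g(1)[of "int i"] Suc.prems by (simp add: read_tape_def eval_nat_numeral)
  qed
  have "exec (Act (move_head j Move_Left)) 1 ts (ts[j := (g, int h - 1)])"
    using exec_Act[of "move_head j Move_Left" ts] j t by (simp add: apply_move_head)
  moreover have "exec (Act (move_head j Move_Right)) 1 (ts[j := (g, - 1)]) (ts[j := (g, 0)])"
    using exec_Act[of "move_head j Move_Right" "ts[j := (g, - 1)]"] j by (simp add: apply_move_head)
  ultimately have "exec (rewind j) (1 + ((3 * h + 1) + 1)) ts (ts[j := (g, 0)])"
    unfolding rewind_def using loop[of h] by (intro exec_Seq) auto
  moreover have "1 + ((3 * h + 1) + 1) = 3 * h + 3" by simp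
  ultimately show ?thesis by metis
qed

lemma length_counters [simp]: "length (counters n L hs) = L"
  by (simp add: counters_def)

lemma counters_update:
  "l < L \<Longrightarrow> (counters n L hs)[l := (segment n (\<lambda>_. 1), int i)] = counters n L (hs(l := i))"
  by (auto simp: counters_def intro!: nth_equalityI simp: nth_list_update)

lemma nth_counters [simp]: "l < L \<Longrightarrow> counters n L hs ! l = (segment n (\<lambda>_. 1), int (hs l))"
  by (simp add: counters_def)

text \<open>This bounds time plus growth of the potential of the input head. A pass takes
  \<open>3 * n + 1\<close> steps for the sweep, \<open>3 * n + 3\<close> for rewinding and adds at
  most \<open>3 * n\<close> to the potential. Rewinding the input takes \<open>3 * p + 5\<close>
  steps, of which the potential pays \<open>3 * p\<close>. A round of \<open>For\<close> adds three
  steps to its body and causes three more when the counter is rewound; the final 4 is the failing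
  test and the constant part of that rewinding.\<close>

primrec time_bound :: "('m, 'c) hl \<Rightarrow> nat poly" where
  "time_bound (Upd g) = 1"
| "time_bound (Pass b f) = [:4, 9:]"
| "time_bound Rewind = 5"
| "time_bound (P ;; Q) = time_bound P + time_bound Q"
| "time_bound (For P) = [:0, 1:] * (time_bound P + 6) + 4"

lemma exec_pass_loop:
  assumes "i \<le> n"
  shows "exec (While (\<lambda>ss. ss ! 1 \<noteq> 0) (Act (pass_acts b f)))
     (3 * (n - i) + 1)
     ((Z, int n + 1 + int (if b then p + i else p)) # (segment n (enc_cell \<circ> d), int i) #
        ((\<lambda>_. 0)(0 := to_nat m), 0) # cs)
     (case fold (pass_step (\<lambda>i. Z (int n + 1 + int i) = 2) b f p) [i..<n] (m, d) of (m', d') \<Rightarrow>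
       (Z, int n + 1 + int (if b then p + n else p)) # (segment n (enc_cell \<circ> d'), int n) #
        ((\<lambda>_. 0)(0 := to_nat m'), 0) # cs)"
  (is "exec ?W _ _ _")
  using assms
proof (induction "n - i" arbitrary: i m d)
  case 0
  then have i: "i = n" by simp
  show ?case
    unfolding i using exec_While_False[of "\<lambda>ss. ss ! 1 \<noteq> 0"]
    by (simp add: read_tape_def segment_def)
next
  case (Suc k)
  have i: "i < n" using Suc by simp
  obtain m' c where f: "f m (d i) (Z (int n + 1 + int (if b then p + i else p)) = 2) = (m', c)"
    by fastforce
  let ?ts = "(Z, int n + 1 + int (if b then p + i else p)) # (segment n (enc_cell \<circ> d), int i) #
        ((\<lambda>_. 0)(0 := to_nat m), 0) # cs"
  let ?ts' = "(Z, int n + 1 + int (if b then p + Suc i else p)) # (segment n (enc_cell \<circ> d(i := c)), int (Suc i)) #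
        ((\<lambda>_. 0)(0 := to_nat m'), 0) # cs"
  have seg: "segment n (enc_cell \<circ> d) (int i) = enc_cell (d i)" using i by (simp add: segment_def)
  have upd: "(segment n (enc_cell \<circ> d))(int i := enc_cell c) = segment n (enc_cell \<circ> d(i := c))"
    using i by (simp add: segment_upd fun_upd_comp)
  have "apply_acts (pass_acts b f) ?ts = ?ts'"
    using f upd seg
    by (simp add: pass_acts_def apply_acts_def keep_Cons apply_acts_keep read_tape_def act_tape_Pair
        numeral_eq_Suc)
  then have step: "exec (Act (pass_acts b f)) 1 ?ts ?ts'" using exec_Act[of "pass_acts b f" ?ts] by (simp only:)
  have rest: "exec ?W (3 * (n - Suc i) + 1) ?ts'
     (case fold (pass_step (\<lambda>i. Z (int n + 1 + int i) = 2) b f p) [Suc i..<n] (m', d(i := c)) of (m', d') \<Rightarrow>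
       (Z, int n + 1 + int (if b then p + n else p)) # (segment n (enc_cell \<circ> d'), int n) #
        ((\<lambda>_. 0)(0 := to_nat m'), 0) # cs)"
    by (rule Suc.hyps) (use Suc i in auto)
  have cond: "map read_tape ?ts ! 1 \<noteq> 0" using seg by (simp add: read_tape_def)
  note exec_While_True[where b = "\<lambda>ss. ss ! 1 \<noteq> 0", OF cond step rest]
  moreover have "Suc (1 + Suc (3 * (n - Suc i) + 1)) = 3 * (n - i) + 1" using i by simp
  moreover have "fold (pass_step (\<lambda>i. Z (int n + 1 + int i) = 2) b f p) [i..<n] (m, d) =
      fold (pass_step (\<lambda>i. Z (int n + 1 + int i) = 2) b f p) [Suc i..<n] (m', d(i := c))"
    using f i by (simp add: upt_conv_Cons pass_step_def)
  ultimately show ?case by (simp only:)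
qed

text \<open>\<open>Rewind\<close> is paid for by the potential \<open>3 * p\<close>, where \<open>p\<close> is the input position.\<close>

lemma exec_compile:
  fixes P :: "('m::countable, 'c::countable) hl"
  assumes "depth P \<le> L" "\<And>l. l < depth P \<Longrightarrow> hs l = 0" "n \<le> N"
    and Z: "Z (int n) = 3" "\<And>j. int n < j \<Longrightarrow> Z j \<noteq> 3"
  shows "\<exists>t. exec (compile P) t (rep Z n L hs s)
       (rep Z n L hs (hexec n (\<lambda>i. Z (int n + 1 + int i) = 2) P s)) \<and>
     t + 3 * snd (snd (hexec n (\<lambda>i. Z (int n + 1 + int i) = 2) P s)) \<le>
       3 * snd (snd s) + poly (time_bound P) N"
  using assms(1,2)
proof (induction P arbitrary: s hs)
  case (Upd g)
  obtain m d p where s: "s = (m, d, p)" by (cases s)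
  have "apply_acts (\<lambda>ss. (keep ss)[2 := (to_nat (g (from_nat (ss ! 2))), Stay)]) (rep Z n L hs s) =
     rep Z n L hs (g m, d, p)"
    by (simp add: s apply_acts_def keep_Cons apply_acts_keep read_tape_def act_tape_Pair
        numeral_eq_Suc)
  then have "exec (compile (Upd g)) 1 (rep Z n L hs s) (rep Z n L hs (g m, d, p))"
    using exec_Act[of "\<lambda>ss. (keep ss)[2 := (to_nat (g (from_nat (ss ! 2))), Stay)]" "rep Z n L hs s"]
    by (simp only: compile.simps)
  then show ?case by (auto simp: s)
next
  case (Pass b f)
  obtain m d p where s: "s = (m, d, p)" by (cases s)
  obtain m' d' where f: "fold (pass_step (\<lambda>i. Z (int n + 1 + int i) = 2) b f p) [0..<n] (m, d) = (m', d')"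
    by fastforce
  let ?ts = "(Z, int n + 1 + int (if b then p + n else p)) # (segment n (enc_cell \<circ> d'), int n) #
        ((\<lambda>_. 0)(0 := to_nat m'), 0) # counters n L hs"
  have "exec (rewind 1) (3 * n + 3) ?ts (?ts[1 := (segment n (enc_cell \<circ> d'), 0)])"
    by (rule exec_rewind) (auto simp: segment_def)
  moreover have "?ts[1 := (segment n (enc_cell \<circ> d'), 0)] = rep Z n L hs (m', d', if b then p + n else p)"
    by simp
  ultimately have rewind: "exec (rewind 1) (3 * n + 3) ?ts (rep Z n L hs (m', d', if b then p + n else p))"
    by (simp only:)
  have "exec (compile (Pass b f)) ((3 * n + 1) + (3 * n + 3)) (rep Z n L hs s)
      (rep Z n L hs (m', d', if b then p + n else p))"
    unfolding compile.simps
  proof (rule exec_Seq[OF _ rewind])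
    show "exec (While (\<lambda>ss. ss ! 1 \<noteq> 0) (Act (pass_acts b f)))
      (3 * n + 1) (rep Z n L hs s) ?ts"
      using exec_pass_loop[where i = 0 and n = n and f = f and b = b and Z = Z and p = p and d = d
          and m = m and cs = "counters n L hs"] f
      by (cases b) (simp_all add: s)
  qed
  moreover have "(3 * n + 1) + (3 * n + 3) + 3 * (if b then p + n else p) \<le> 3 * p + (4 + N * 9)"
    using assms(3) by auto
  ultimately show ?case using f by (intro exI[of _ "(3 * n + 1) + (3 * n + 3)"]) (simp add: s)
next
  case Rewind
  obtain m d p where s: "s = (m, d, p)" by (cases s)
  let ?ts = "\<lambda>i::nat. (Z, int n + int i) # tl (rep Z n L hs s)"
  let ?W = "While (\<lambda>ss. ss ! 0 \<noteq> 3) (Act (move_head 0 Move_Left))"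
  have "exec ?W (3 * i + 1) (?ts i) (?ts 0)" for i
  proof (induction i)
    case 0
    show ?case using exec_While_False[of "\<lambda>ss. ss ! 0 \<noteq> 3" "?ts 0"] Z by (simp add: read_tape_def)
  next
    case (Suc i)
    have "exec (Act (move_head 0 Move_Left)) 1 (?ts (Suc i)) (?ts i)"
      using exec_Act[of "move_head 0 Move_Left" "?ts (Suc i)"] by (simp add: apply_move_head)
    from exec_While_True[OF _ this Suc.IH] show ?case
      using Z(2)[of "int n + 1 + int i"] by (simp add: read_tape_def eval_nat_numeral algebra_simps)
  qed
  then have loop: "exec ?W (3 * Suc p + 1) (?ts (Suc p)) (?ts 0)" .
  have start: "?ts (Suc p) = rep Z n L hs s" by (simp add: s)
  have right: "exec (Act (move_head 0 Move_Right)) 1 (?ts 0) (rep Z n L hs (m, d, 0))"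
    using exec_Act[of "move_head 0 Move_Right" "?ts 0"] by (simp add: s apply_move_head)
  have "exec (compile Rewind) (3 * Suc p + 1 + 1) (rep Z n L hs s) (rep Z n L hs (m, d, 0))"
    using exec_Seq[OF loop right] unfolding start compile.simps .
  then show ?case by (intro exI[of _ "3 * Suc p + 1 + 1"]) (simp add: s)
next
  case (Then P Q)
  let ?i = "\<lambda>i. Z (int n + 1 + int i) = 2"
  obtain t where t: "exec (compile P) t (rep Z n L hs s) (rep Z n L hs (hexec n ?i P s))"
     "t + 3 * snd (snd (hexec n ?i P s)) \<le> 3 * snd (snd s) + poly (time_bound P) N"
    using Then.IH(1)[of hs s] Then.prems by auto
  obtain t' where t': "exec (compile Q) t' (rep Z n L hs (hexec n ?i P s)) (rep Z n L hs (hexec n ?i (P ;; Q) s))"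
     "t' + 3 * snd (snd (hexec n ?i (P ;; Q) s)) \<le> 3 * snd (snd (hexec n ?i P s)) + poly (time_bound Q) N"
    using Then.IH(2)[of hs "hexec n ?i P s"] Then.prems by auto
  have "exec (compile (P ;; Q)) (t + t') (rep Z n L hs s) (rep Z n L hs (hexec n ?i (P ;; Q) s))"
    using exec_Seq[OF t(1) t'(1)] by simp
  then show ?case using t(2) t'(2) by (intro exI[of _ "t + t'"]) simp
next
  case (For P)
  let ?i = "\<lambda>i. Z (int n + 1 + int i) = 2"
  let ?l = "depth P"
  let ?W = "While (\<lambda>ss. ss ! (3 + ?l) \<noteq> 0) (Seq (compile P) (Act (move_head (3 + ?l) Move_Right)))"
  have l: "?l < L" using For.prems by simp
  have nth: "rep Z n L hs s ! (3 + ?l) = (segment n (\<lambda>_. 1), int (hs ?l))" for hs and s :: "('m, 'c) hstate"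
    using l by (cases s) (simp add: numeral_eq_Suc)
  have len: "length (rep Z n L hs s) = 3 + L" for hs and s :: "('m, 'c) hstate"
    by (cases s) simp
  \<comment> \<open>Only the counter of this loop advances. The induction hypothesis needs the
    counters of smaller depth at zero, and each run of the body returns all counters to where it
    found them.\<close>
  define H where "H i = hs(?l := i)" for i
  have H_low: "H i j = 0" if "j < depth P" for i j using that For.prems(2)[of j] by (simp add: H_def)
  have H_at: "H i ?l = i" for i by (simp add: H_def)
  have upd: "(rep Z n L hs s)[3 + ?l := (segment n (\<lambda>_. 1), int i)] = rep Z n L (H i) s"
    if "hs = H j" for i j hs and s :: "('m, 'c) hstate"
    unfolding that H_def using l by (cases s) (simp add: numeral_eq_Suc counters_update[unfolded One_nat_def])
  have loop: "\<exists>t. exec ?W t (rep Z n L (H (n - k)) s) (rep Z n L (H n) ((hexec n ?i P ^^ k) s)) \<and>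
     t + 3 * snd (snd ((hexec n ?i P ^^ k) s)) \<le> 3 * snd (snd s) + k * (poly (time_bound P) N + 3) + 1"
    if "k \<le> n" for k s
    using that
  proof (induction k arbitrary: s)
    case 0
    have "exec ?W 1 (rep Z n L (H n) s) (rep Z n L (H n) s)"
      by (rule exec_While_False) (simp add: nth H_at len l read_tape_def segment_def)
    then show ?case by auto
  next
    case (Suc k)
    obtain t where t: "exec (compile P) t (rep Z n L (H (n - Suc k)) s) (rep Z n L (H (n - Suc k)) (hexec n ?i P s))"
     "t + 3 * snd (snd (hexec n ?i P s)) \<le> 3 * snd (snd s) + poly (time_bound P) N"
      using For.IH[where hs = "H (n - Suc k)" and s = s, OF less_imp_le[OF l] H_low] by blast
    have "exec (Act (move_head (3 + ?l) Move_Right)) 1 (rep Z n L (H (n - Suc k)) (hexec n ?i P s))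
       (rep Z n L (H (n - k)) (hexec n ?i P s))"
      using exec_Act[of "move_head (3 + ?l) Move_Right" "rep Z n L (H (n - Suc k)) (hexec n ?i P s)"]
        upd[OF refl, of "n - Suc k" "hexec n ?i P s" "n - k"] Suc.prems l
      by (simp add: apply_move_head nth H_at len of_nat_diff)
    from exec_Seq[OF t(1) this]
    have body: "exec (Seq (compile P) (Act (move_head (3 + ?l) Move_Right))) (t + 1)
       (rep Z n L (H (n - Suc k)) s) (rep Z n L (H (n - k)) (hexec n ?i P s))" .
    obtain t' where t': "exec ?W t' (rep Z n L (H (n - k)) (hexec n ?i P s))
        (rep Z n L (H n) ((hexec n ?i P ^^ k) (hexec n ?i P s)))"
      "t' + 3 * snd (snd ((hexec n ?i P ^^ k) (hexec n ?i P s))) \<le>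
         3 * snd (snd (hexec n ?i P s)) + k * (poly (time_bound P) N + 3) + 1"
      using Suc.IH[of "hexec n ?i P s"] Suc.prems by auto
    have "exec ?W (Suc ((t + 1) + Suc t')) (rep Z n L (H (n - Suc k)) s)
        (rep Z n L (H n) ((hexec n ?i P ^^ k) (hexec n ?i P s)))"
      by (rule exec_While_True[OF _ body t'(1)])
        (use Suc.prems in \<open>simp add: nth H_at len l read_tape_def segment_def\<close>)
    moreover have "(hexec n ?i P ^^ k) (hexec n ?i P s) = (hexec n ?i P ^^ Suc k) s"
      by (simp add: funpow_swap1)
    ultimately show ?case
      using t(2) t'(2) by (intro exI[of _ "Suc ((t + 1) + Suc t')"]) (simp add: algebra_simps)
  qed
  obtain t where t: "exec ?W t (rep Z n L (H 0) s) (rep Z n L (H n) ((hexec n ?i P ^^ n) s))"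
     "t + 3 * snd (snd ((hexec n ?i P ^^ n) s)) \<le> 3 * snd (snd s) + n * (poly (time_bound P) N + 3) + 1"
    using loop[of n s] by auto
  have hs: "H 0 = hs" using For.prems(2)[of ?l] by (auto simp: H_def)
  let ?ts = "rep Z n L (H n) ((hexec n ?i P ^^ n) s)"
  have "exec (rewind (3 + ?l)) (3 * n + 3) ?ts (?ts[3 + ?l := (segment n (\<lambda>_. 1), 0)])"
    by (rule exec_rewind) (auto simp: segment_def nth H_at len l)
  then have "exec (rewind (3 + ?l)) (3 * n + 3) ?ts (rep Z n L hs ((hexec n ?i P ^^ n) s))"
    using upd[OF refl, of n "(hexec n ?i P ^^ n) s" 0] hs by simp
  from exec_Seq[OF t(1) this]
  have "exec (compile (For P)) (t + (3 * n + 3)) (rep Z n L hs s) (rep Z n L hs (hexec n ?i (For P) s))"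
    unfolding hs by simp
  moreover have "n * (poly (time_bound P) N + 6) \<le> N * (poly (time_bound P) N + 6)"
    using assms(3) by simp
  ultimately show ?case using t(2)
    by (intro exI[of _ "t + (3 * n + 3)"]) (simp add: algebra_simps)
qed

section \<open>Well-formedness of the compiled programs\<close>

lemma wf_acts_update:
  assumes "length as = k \<and> fst ` set as \<subseteq> {..<K}" "fst a < K"
  shows "length (as[j := a]) = k \<and> fst ` set (as[j := a]) \<subseteq> {..<K}"
  using assms set_update_subset_insert[of as j a] by fastforce

lemma wf_keep: "length ss = k \<Longrightarrow> set ss \<subseteq> {..<K} \<Longrightarrow> length (keep ss) = k \<and> fst ` set (keep ss) \<subseteq> {..<K}"
  by (auto simp: keep_def)

lemma symbol_bound: "set ss \<subseteq> {..<K} \<Longrightarrow> i < length ss \<Longrightarrow> ss ! i < K"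
  by (meson lessThan_iff nth_mem subsetD)

lemma wf_move_head: "j < k \<Longrightarrow> wf_prog k K (Act (move_head j d))"
  unfolding wf_prog.simps move_head_def
  by (intro allI impI wf_acts_update wf_keep) (auto intro: symbol_bound)

lemma wf_compile:
  fixes P :: "('m::countable, 'c::countable) hl"
  assumes "3 + depth P \<le> k" and K: "\<And>m::'m. to_nat m < K" "\<And>c::'c. enc_cell c < K"
  shows "wf_prog k K (compile P)"
  using assms(1)
proof (induction P)
  case (Upd g)
  show ?case
    unfolding compile.simps wf_prog.simps by (intro allI impI wf_acts_update wf_keep) (use K in auto)
next
  case (Pass b f)
  have "wf_prog k K (Act (pass_acts b f))"
    unfolding wf_prog.simps
  proof (intro allI impI)
    fix ss :: "nat list" assume ss: "length ss = k" "set ss \<subseteq> {..<K}"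
    obtain m c where f: "f (from_nat (ss ! 2)) (dec_cell (ss ! 1)) (ss ! 0 = 2) = (m, c)" by fastforce
    have "ss ! 0 < K" using ss Pass.prems by (auto intro: symbol_bound)
    then show "length (pass_acts b f ss) = k \<and> fst ` set (pass_acts b f ss) \<subseteq> {..<K}"
      unfolding pass_acts_def f prod.case using K ss by (intro wf_acts_update wf_keep) auto
  qed
  then show ?case
    unfolding compile.simps rewind_def wf_prog.simps(2,3)
    by (intro conjI wf_move_head) (use Pass.prems in auto)
next
  case Rewind
  then show ?case
    unfolding compile.simps wf_prog.simps(2,3) by (intro conjI wf_move_head) auto
next
  case (Then P Q)
  then show ?case by simp
next
  case (For P)
  then show ?case
    unfolding compile.simps rewind_def wf_prog.simps(2,3) by (intro conjI wf_move_head For.IH) auto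
qed

section \<open>Setting up the tapes\<close>

definition shift_all :: "move \<Rightarrow> nat list \<Rightarrow> (nat \<times> move) list" where
  "shift_all d ss = (ss ! 0, Stay) # (ss ! 1, d) # (ss ! 2, Stay) # map (\<lambda>s. (s, d)) (drop 3 ss)"

definition fill :: "nat \<Rightarrow> nat \<Rightarrow> nat list \<Rightarrow> (nat \<times> move) list" where
  "fill L s ss = (2, Move_Right) # (s, Move_Right) # (ss ! 2, Stay) # replicate L (1, Move_Right)"

definition close :: "nat \<Rightarrow> nat list \<Rightarrow> (nat \<times> move) list" where
  "close s ss = (3, Move_Right) # (ss ! 1, Move_Left) # (s, Stay) # map (\<lambda>s. (s, Move_Left)) (drop 3 ss)"

text \<open>The row and the counters are as long as the prefix of ones and are written in lockstep
  with reading it. At the first other symbol, a blank if nothing follows, the marker 3 and the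
  initial memory are written in one step; then the heads of all filled blocks walk back
  together.\<close>

definition init_prog :: "nat \<Rightarrow> nat \<Rightarrow> nat \<Rightarrow> prog" where
  "init_prog L s s' = Seq (While (\<lambda>ss. ss ! 0 = 2) (Act (fill L s)))
     (Seq (Act (close s'))
     (Seq (While (\<lambda>ss. ss ! 1 \<noteq> 0) (Act (shift_all Move_Left))) (Act (shift_all Move_Right))))"

lemma wf_init_prog:
  assumes "s < K" "s' < K" "4 \<le> K"
  shows "wf_prog (3 + L) K (init_prog L s s')"
proof -
  have nth: "ss ! i < K" if "length ss = 3 + L" "set ss \<subseteq> {..<K}" "i < 3" for ss i
    using that by (auto intro: symbol_bound)
  have drop: "s < K" if "set ss \<subseteq> {..<K}" "s \<in> set (drop 3 ss)" for s ss
    using that set_drop_subset[of 3 ss] by auto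
  show ?thesis
    using assms nth drop
    by (auto simp: init_prog_def shift_all_def fill_def close_def image_subset_iff)
qed

lemma map2_replicate: "map2 f (replicate n a) (replicate n b) = replicate n (f a b)"
  by (induction n) auto

lemma map2_map_replicate: "map2 f (map g (replicate n a)) (replicate n b) = replicate n (f (g a) b)"
  by (induction n) auto

context
  fixes Z :: "int \<Rightarrow> nat" and n L :: nat and m :: "'m::countable" and c :: "'c::countable"
  assumes Z: "\<And>i. i < n \<Longrightarrow> Z (int i) = 2" "Z (int n) \<noteq> 2"
begin

lemma exec_init_prog:
  "exec (init_prog L (enc_cell c) (to_nat m)) (6 * n + 4)
     ((Z, 0) # replicate (2 + L) blank_tape) (rep (Z(int n := 3)) n L (\<lambda>_. 0) (m, \<lambda>_. c, 0))"
proof -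
  let ?b = "((\<lambda>_. 0, 0) :: tape)"
  define Z' where "Z' = Z(int n := 3)"
  define mem :: "int \<Rightarrow> nat" where "mem = (\<lambda>_. 0)(0 := to_nat m)"
  let ?ts = "\<lambda>i. (Z, int i) # (segment i (\<lambda>_. enc_cell c), int i) # ?b # replicate L (segment i (\<lambda>_. 1), int i)"
  let ?us = "\<lambda>i::int. (Z', int n + 1) # (segment n (\<lambda>_. enc_cell c), i) # (mem, 0) #
      replicate L (segment n (\<lambda>_. 1), i)"
  let ?W = "While (\<lambda>ss. ss ! 0 = 2) (Act (fill L (enc_cell c)))"
  let ?V = "While (\<lambda>ss. ss ! 1 \<noteq> 0) (Act (shift_all Move_Left))"
  have loop1: "exec ?W (3 * k + 1) (?ts (n - k)) (?ts n)" if "k \<le> n" for k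
    using that
  proof (induction k)
    case 0
    show ?case using exec_While_False[of "\<lambda>ss. ss ! 0 = 2" "?ts n"] Z by (simp add: read_tape_def)
  next
    case (Suc k)
    define i where "i = n - Suc k"
    have i: "n - k = Suc i" "i < n" using Suc.prems by (auto simp: i_def)
    have ext: "(segment i f)(int i := s) = segment (Suc i) (\<lambda>_. s)" if "f = (\<lambda>_. s)" for f s
      unfolding that segment_extend by (rule segment_cong) auto
    have "apply_acts (fill L (enc_cell c)) (?ts i) = ?ts (Suc i)"
      using Z(1)[OF i(2)] ext
      by (simp add: apply_acts_def fill_def read_tape_def act_tape_Pair map2_replicate fun_upd_idem)
    then have "exec (Act (fill L (enc_cell c))) 1 (?ts i) (?ts (n - k))"
      using exec_Act[of "fill L (enc_cell c)" "?ts i"] i by simp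
    from exec_While_True[where b = "\<lambda>ss. ss ! 0 = 2", OF _ this Suc.IH] show ?case
      using Z(1)[OF i(2)] Suc.prems i_def by (simp add: read_tape_def eval_nat_numeral)
  qed
  have close: "exec (Act (close (to_nat m))) 1 (?ts n) (?us (int n - 1))"
  proof -
    have "apply_acts (close (to_nat m)) (?ts n) = ?us (int n - 1)"
      by (simp add: apply_acts_def close_def read_tape_def act_tape_Pair map2_map_replicate
          fun_upd_idem numeral_eq_Suc Z'_def mem_def)
    then show ?thesis using exec_Act[of "close (to_nat m)" "?ts n"] by simp
  qed
  have shift: "apply_acts (shift_all d) (?us i) = ?us (i + head_offset d)" for i d
    by (simp add: apply_acts_def shift_all_def read_tape_def act_tape_Pair map2_map_replicate
          fun_upd_idem numeral_eq_Suc)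
  have loop2: "exec ?V (3 * k + 1) (?us (int k - 1)) (?us (- 1))" if "k \<le> n" for k
    using that
  proof (induction k)
    case 0
    have "exec ?V 1 (?us (- 1)) (?us (- 1))"
      by (rule exec_While_False) (simp add: read_tape_def)
    then show ?case by (simp only: mult_0_right add_0 of_nat_0 diff_0)
  next
    case (Suc k)
    have "exec (Act (shift_all Move_Left)) 1 (?us (int k)) (?us (int k - 1))"
      using exec_Act[of "shift_all Move_Left" "?us (int k)"] shift[of Move_Left "int k"] by simp
    from exec_While_True[where b = "\<lambda>ss. ss ! 1 \<noteq> 0", OF _ this Suc.IH] show ?case
      using Suc.prems by (simp add: read_tape_def eval_nat_numeral)
  qed
  have right: "exec (Act (shift_all Move_Right)) 1 (?us (- 1)) (?us 0)"
    using exec_Act[of "shift_all Move_Right" "?us (- 1)"] shift[of Move_Right "- 1"] by simp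
  have loop1': "exec ?W (3 * n + 1) (?ts 0) (?ts n)" using loop1[of n] by simp
  have "exec (init_prog L (enc_cell c) (to_nat m)) (3 * n + 1 + (1 + (3 * n + 1 + 1))) (?ts 0) (?us 0)"
    unfolding init_prog_def
    by (rule exec_Seq[OF loop1' exec_Seq[OF close exec_Seq[OF loop2[of n] right]]]) simp
  moreover have "3 * n + 1 + (1 + (3 * n + 1 + 1)) = 6 * n + 4" by simp
  moreover have "?ts 0 = (Z, 0) # replicate (2 + L) blank_tape"
    by (simp add: blank_tape_def segment_def fun_eq_iff)
  moreover have "?us 0 = rep (Z(int n := 3)) n L (\<lambda>_. 0) (m, \<lambda>_. c, 0)"
    by (simp add: counters_def map_replicate_const comp_def Z'_def mem_def)
  ultimately show ?thesis by (simp only:)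
qed

end

text \<open>This is all that the decision procedure uses about machines. It covers arbitrary
  strings: \<open>n\<close> is the number of leading ones whatever follows, and bits beyond the end
  read as False. Finiteness of both types bounds the alphabet.\<close>

theorem hl_polynomial_time:
  fixes P :: "('m::finite, 'c::finite) hl"
  shows "\<exists>M. wf_tm M \<and> polynomial_time M \<and> (\<forall>x. accepts M x \<longleftrightarrow>
     acc (fst (hexec (length (takeWhile id x))
       (\<lambda>i. length (takeWhile id x) + 1 + i < length x \<and> x ! (length (takeWhile id x) + 1 + i)) P
       (m, \<lambda>_. c, 0))))"
proof -
  \<comment> \<open>The marker 3 may coincide with the code of a memory value or a cell: it is
    looked for only on the input tape, where no other symbol exceeds 2.\<close>
  define S where "S = insert 3 (range (to_nat :: 'm \<Rightarrow> nat) \<union> range (enc_cell :: 'c \<Rightarrow> nat))"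
  define K where "K = Suc (Max S)"
  have S: "s < K" if "s \<in> S" for s
  proof -
    have "finite S" by (simp add: S_def)
    from Max_ge[OF this that] show ?thesis unfolding K_def by simp
  qed
  have K: "to_nat m < K" "enc_cell c < K" "4 \<le> K" for m :: 'm and c :: 'c
    using S[of "to_nat m"] S[of "enc_cell c"] S[of 3] by (auto simp: S_def)
  define L where "L = depth P"
  define p where "p = Seq (init_prog L (enc_cell c) (to_nat m)) (compile P)"
  define M where "M = machine (3 + L) K p (\<lambda>ss. acc (from_nat (ss ! 2)))"
  have wf: "wf_tm M"
    unfolding M_def p_def L_def
    by (rule wf_machine) (use wf_compile[of P] wf_init_prog K in auto)
  \<comment> \<open>Setting up takes \<open>6 * n + 4\<close> steps; the step from the end of the
    program into a halting state makes the constant 5.\<close>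
  have run: "\<exists>t \<le> poly ([:5, 6:] + time_bound P) (length x). fst (config_at M x t) =
     (if acc (fst (hexec (length (takeWhile id x))
       (\<lambda>i. length (takeWhile id x) + 1 + i < length x \<and> x ! (length (takeWhile id x) + 1 + i)) P
       (m, \<lambda>_. c, 0))) then accept_state M else reject_state M)" for x
  proof -
    define n where "n = length (takeWhile id x)"
    define Z where "Z = fst (input_tape x)"
    have n: "n \<le> length x" unfolding n_def by (rule length_takeWhile_le)
    have Z2: "Z (int i) = 2" if "i < n" for i
      using that n nth_mem[of i "takeWhile id x"] set_takeWhileD[of "x ! i" id x]
      by (auto simp: Z_def input_tape_def n_def takeWhile_nth)
    have Zn: "Z (int n) \<noteq> 2"
      using nth_length_takeWhile[of id x] by (auto simp: Z_def input_tape_def n_def)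
    have Z3: "(Z(int n := 3)) (int n) = 3" "\<And>j. int n < j \<Longrightarrow> (Z(int n := 3)) j \<noteq> 3"
      by (auto simp: Z_def input_tape_def)
    have inp: "(Z(int n := 3)) (int n + 1 + int i) = 2 \<longleftrightarrow> n + 1 + i < length x \<and> x ! (n + 1 + i)" for i
    proof -
      have "nat (int n + 1 + int i) = n + 1 + i" by arith
      then show ?thesis unfolding Z_def input_tape_def by auto
    qed
    let ?s = "hexec n (\<lambda>i. n + 1 + i < length x \<and> x ! (n + 1 + i)) P (m, \<lambda>_. c, 0)"
    obtain t where t: "exec (compile P) t (rep (Z(int n := 3)) n L (\<lambda>_. 0) (m, \<lambda>_. c, 0))
        (rep (Z(int n := 3)) n L (\<lambda>_. 0) ?s)"
      "t + 3 * snd (snd ?s) \<le> poly (time_bound P) (length x)"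
      using exec_compile[of P L "\<lambda>_. 0" n "length x" "Z(int n := 3)" "(m, \<lambda>_. c, 0)", OF _ _ n Z3]
      unfolding inp L_def by auto
    have "exec p (6 * n + 4 + t) ((Z, 0) # replicate (2 + L) blank_tape) (rep (Z(int n := 3)) n L (\<lambda>_. 0) ?s)"
      unfolding p_def by (rule exec_Seq[OF exec_init_prog t(1)]) (use Z2 Zn in auto)
    moreover have "snd (initial_config (machine (3 + L) K p (\<lambda>ss. acc (from_nat (ss ! 2)))) x) =
       (Z, 0) # replicate (2 + L) blank_tape"
      by (simp add: initial_config_def machine_def Z_def input_tape_def)
    ultimately have "fst (config_at M x (Suc (6 * n + 4 + t))) =
      (if acc (from_nat (map read_tape (rep (Z(int n := 3)) n L (\<lambda>_. 0) ?s) ! 2))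
       then code_length p + 1 else code_length p + 2)"
      unfolding M_def by (intro machine_halts) simp
    moreover have "map read_tape (rep (Z(int n := 3)) n L (\<lambda>_. 0) s) ! 2 = to_nat (fst s)"
      for s :: "('m, 'c) hstate"
      by (cases s) (simp add: read_tape_def)
    ultimately have "fst (config_at M x (Suc (6 * n + 4 + t))) =
      (if acc (fst ?s) then accept_state M else reject_state M)"
      by (simp add: M_def machine_def)
    moreover have "Suc (6 * n + 4 + t) \<le> poly ([:5, 6:] + time_bound P) (length x)"
      using t(2) n by simp
    ultimately show ?thesis unfolding n_def by blast
  qed
  have "polynomial_time M"
    unfolding polynomial_time_def
  proof (intro exI allI)
    fix x
    from run[of x] obtain t where t: "t \<le> poly ([:5, 6:] + time_bound P) (length x)"
      "fst (config_at M x t) \<in> halting_states M"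
      by (auto simp: halting_states_def split: if_splits)
    then show "fst (config_at M x (poly ([:5, 6:] + time_bound P) (length x))) \<in> halting_states M"
      using halting_mono by metis
  qed
  moreover have "accepts M x \<longleftrightarrow> acc (fst (hexec (length (takeWhile id x))
       (\<lambda>i. length (takeWhile id x) + 1 + i < length x \<and> x ! (length (takeWhile id x) + 1 + i)) P
       (m, \<lambda>_. c, 0)))" for x
  proof -
    from run[of x] obtain t where t: "fst (config_at M x t) =
     (if acc (fst (hexec (length (takeWhile id x))
       (\<lambda>i. length (takeWhile id x) + 1 + i < length x \<and> x ! (length (takeWhile id x) + 1 + i)) P
       (m, \<lambda>_. c, 0))) then accept_state M else reject_state M)" by blast
    then have "fst (config_at M x t) \<in> halting_states M" by (simp add: halting_states_def)
    from accepts_iff_halting[OF wf this] show ?thesis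
      using t wf by (auto simp: wf_tm_def)
  qed
  ultimately show ?thesis using wf by blast
qed

section \<open>Invariants for passes and loops\<close>

definition cells :: "nat \<Rightarrow> 'c \<Rightarrow> (nat \<Rightarrow> 'c) \<Rightarrow> nat \<Rightarrow> 'c" where
  "cells n c D i = (if i < n then D i else c)"

text \<open>\<open>M i\<close> is the memory before cell \<open>i\<close>; supplying it in closed
  form reduces a pass to a check at each cell. \<open>cells\<close> pins everything from index
  \<open>n\<close> on to a default, so that rows with the same contents are equal as
  functions.\<close>

lemma fold_pass_step:
  assumes "\<And>i. i < n \<Longrightarrow> f (M i) (D i) (inp (if b then p + i else p)) = (M (Suc i), D' i)" "k \<le> n"
  shows "fold (pass_step inp b f p) [0..<k] (M 0, cells n c D) =
    (M k, cells n c (\<lambda>i. if i < k then D' i else D i))"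
  using assms(2)
proof (induction k)
  case (Suc k)
  have "cells n c (\<lambda>i. if i < k then D' i else D i) k = D k" using Suc.prems by (simp add: cells_def)
  moreover have "(cells n c (\<lambda>i. if i < k then D' i else D i))(k := D' k) =
      cells n c (\<lambda>i. if i < Suc k then D' i else D i)"
    using Suc.prems by (auto simp: cells_def fun_eq_iff)
  ultimately show ?case using Suc assms(1)[of k] by (simp add: pass_step_def)
qed (simp add: cells_def)

lemma hexec_Pass:
  assumes "\<And>i. i < n \<Longrightarrow> f (M i) (D i) (inp (if b then p + i else p)) = (M (Suc i), D' i)"
  shows "hexec n inp (Pass b f) (M 0, cells n c D, p) =
    (M n, cells n c D', if b then p + n else p)"
proof -
  have "cells n c (\<lambda>i. if i < n then D' i else D i) = cells n c D'"
    by (auto simp: cells_def fun_eq_iff)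
  then show ?thesis using fold_pass_step[of n f M D inp b p D' n c] assms by simp
qed

lemma hexec_For:
  assumes "J 0 s" "\<And>i s. i < n \<Longrightarrow> J i s \<Longrightarrow> J (Suc i) (hexec n inp P s)"
  shows "J n (hexec n inp (For P) s)"
proof -
  have "k \<le> n \<Longrightarrow> J k ((hexec n inp P ^^ k) s)" for k
    by (induction k) (use assms in auto)
  then show ?thesis by simp
qed

section \<open>Colourings and cliques of co-graphs\<close>

abbreviation adj :: "'a graph \<Rightarrow> 'a \<Rightarrow> 'a \<Rightarrow> bool" where
  "adj G u v \<equiv> {u, v} \<in> edges G"

definition clique :: "'a graph \<Rightarrow> 'a set \<Rightarrow> bool" where
  "clique G K \<longleftrightarrow> K \<subseteq> vertices G \<and> (\<forall>u\<in>K. \<forall>v\<in>K. u \<noteq> v \<longrightarrow> adj G u v)"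

lemma cograph_edge_subset: "cograph G \<Longrightarrow> adj G u v \<Longrightarrow> u \<in> vertices G \<and> v \<in> vertices G"
  using cograph_simple_graph[of G] by (auto simp: simple_graph_def)

lemma cograph_irrefl: "cograph G \<Longrightarrow> \<not> adj G u u"
  using cograph_simple_graph[of G] by (force simp: simple_graph_def)

lemma cograph_finite: "cograph G \<Longrightarrow> finite (vertices G)"
  using cograph_simple_graph[of G] by (auto simp: simple_graph_def)

lemma vertices_union [simp]: "vertices (graph_union G H) = vertices G \<union> vertices H"
  by (simp add: graph_union_def)

lemma vertices_join [simp]: "vertices (graph_join G H) = vertices G \<union> vertices H"
  by (simp add: graph_join_def)

lemma adj_union [simp]: "adj (graph_union G H) u v \<longleftrightarrow> adj G u v \<or> adj H u v"
  by (simp add: graph_union_def)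

lemma adj_join [simp]:
  "adj (graph_join G H) u v \<longleftrightarrow> adj G u v \<or> adj H u v \<or>
    u \<in> vertices G \<and> v \<in> vertices H \<or> v \<in> vertices G \<and> u \<in> vertices H"
  by (auto simp: graph_join_def doubleton_eq_iff)

section \<open>Cliques and colourings under join and union\<close>

lemma clique_join:
  "clique G K \<Longrightarrow> clique H L \<Longrightarrow> clique (graph_join G H) (K \<union> L)"
  unfolding clique_def by (auto; blast)

lemma clique_union: "clique G K \<or> clique H K \<Longrightarrow> clique (graph_union G H) K"
  by (auto simp: clique_def)

text \<open>This serves one side of a join, whose colours form an arbitrary subset of those of the
  whole graph: only their number matters.\<close>

lemma proper_coloring_compress:
  assumes c: "finite (vertices G)" "card (c ` vertices G) \<le> m"
    "\<And>u v. adj G u v \<Longrightarrow> u \<in> vertices G \<and> v \<in> vertices G \<and> c u \<noteq> c v"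
  shows "\<exists>c'. proper_coloring G m c'"
proof -
  obtain f where f: "inj_on f (c ` vertices G)" "f ` (c ` vertices G) \<subseteq> {..<m}"
    using c(1,2) card_le_inj[of "c ` vertices G" "{..<m}"] by auto
  have "proper_coloring G m (f \<circ> c)"
    unfolding proper_coloring_def
  proof (intro conjI allI impI)
    show "(f \<circ> c) ` vertices G \<subseteq> {..<m}" using f(2) by auto
    fix u v assume "adj G u v"
    then show "(f \<circ> c) u \<noteq> (f \<circ> c) v" using c(3)[of u v] f(1) by (auto dest: inj_onD)
  qed
  then show ?thesis by blast
qed

lemma proper_coloring_union:
  assumes "cograph G" "cograph H" "vertices G \<inter> vertices H = {}"
    "proper_coloring G k c" "proper_coloring H k d"
  shows "proper_coloring (graph_union G H) k (\<lambda>x. if x \<in> vertices G then c x else d x)"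
proof -
  have "\<not> (adj H u v \<and> (u \<in> vertices G \<or> v \<in> vertices G))" for u v
    using assms(3) cograph_edge_subset[OF assms(2), of u v] by blast
  then show ?thesis
    using assms(4,5) cograph_edge_subset[OF assms(1)]
    by (fastforce simp: proper_coloring_def)
qed

lemma proper_coloring_join:
  assumes "cograph G" "cograph H" "vertices G \<inter> vertices H = {}"
    "proper_coloring G k c" "proper_coloring H l d"
  shows "proper_coloring (graph_join G H) (k + l) (\<lambda>x. if x \<in> vertices G then c x else k + d x)"
proof -
  have A: "c x < k" if "x \<in> vertices G" for x using that assms(4) by (auto simp: proper_coloring_def)
  have B: "d x < l" if "x \<in> vertices H" for x using that assms(5) by (auto simp: proper_coloring_def)
  have G: "u \<in> vertices G \<and> v \<in> vertices G \<and> c u \<noteq> c v" if "adj G u v" for u v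
    using assms(4) cograph_edge_subset[OF assms(1) that] that by (simp add: proper_coloring_def)
  have H: "u \<notin> vertices G \<and> v \<notin> vertices G \<and> d u \<noteq> d v" if "adj H u v" for u v
    using assms(3,5) cograph_edge_subset[OF assms(2) that] that by (auto simp: proper_coloring_def)
  have H': "x \<notin> vertices G" if "x \<in> vertices H" for x
    using assms(3) that by blast
  show ?thesis
    unfolding proper_coloring_def
  proof (intro conjI allI impI)
    show "(\<lambda>x. if x \<in> vertices G then c x else k + d x) ` vertices (graph_join G H) \<subseteq> {..<k + l}"
      using A B by (auto simp: trans_less_add1)
    fix u v assume "adj (graph_join G H) u v"
    then consider "adj G u v" | "adj H u v" | "u \<in> vertices G" "v \<in> vertices H"
      | "v \<in> vertices G" "u \<in> vertices H" unfolding adj_join by blast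
    then show "(if u \<in> vertices G then c u else k + d u) \<noteq> (if v \<in> vertices G then c v else k + d v)"
    proof cases
      case 1
      then show ?thesis using G[of u v] by simp
    next
      case 2
      then show ?thesis using H[of u v] by simp
    next
      case 3
      then show ?thesis using A[of u] H'[of v] by simp
    next
      case 4
      then show ?thesis using A[of v] H'[of u] by simp
    qed
  qed
qed

lemma proper_coloring_mono: "proper_coloring G k c \<Longrightarrow> k \<le> l \<Longrightarrow> proper_coloring G l c"
  by (auto simp: proper_coloring_def)

text \<open>A colouring and a clique of the same size certify each other as optimal; both sizes
  behave as a maximum under union and as a sum under join.\<close>

lemma cograph_perfect:
  assumes "cograph G"
  shows "\<exists>k c K. proper_coloring G k c \<and> clique G K \<and> card K = k"
  using assms
proof induction
  case (cograph_single v)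
  have "proper_coloring ({v}, {}) 1 (\<lambda>_. 0)" "clique ({v}, {}) {v}"
    by (auto simp: proper_coloring_def clique_def)
  then show ?case by fastforce
next
  case (cograph_union G H)
  then obtain k c K l d L where *: "proper_coloring G k c" "clique G K" "card K = k"
    "proper_coloring H l d" "clique H L" "card L = l" by blast
  have "proper_coloring (graph_union G H) (max k l) (\<lambda>x. if x \<in> vertices G then c x else d x)"
    by (rule proper_coloring_union)
      (use cograph_union * in \<open>auto intro: proper_coloring_mono\<close>)
  moreover have "clique (graph_union G H) (if k \<le> l then L else K)"
    using * by (auto intro: clique_union)
  moreover have "card (if k \<le> l then L else K) = max k l" using * by auto
  ultimately show ?case by blast
next
  case (cograph_join G H)
  then obtain k c K l d L where *: "proper_coloring G k c" "clique G K" "card K = k"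
    "proper_coloring H l d" "clique H L" "card L = l" by blast
  have "proper_coloring (graph_join G H) (k + l) (\<lambda>x. if x \<in> vertices G then c x else k + d x)"
    by (rule proper_coloring_join) (use cograph_join * in auto)
  moreover have "clique (graph_join G H) (K \<union> L)"
    using * by (auto intro: clique_join)
  moreover have "card (K \<union> L) = k + l"
  proof -
    have "K \<subseteq> vertices G" "L \<subseteq> vertices H" using * by (auto simp: clique_def)
    then have "finite K" "finite L" "K \<inter> L = {}"
      using cograph_join.hyps cograph_finite[OF cograph_join.hyps(1)]
        cograph_finite[OF cograph_join.hyps(2)] by (blast intro: finite_subset)+
    then show ?thesis using * by (simp add: card_Un_disjoint)
  qed
  ultimately show ?case by blast
qed

lemma clique_card_le:
  assumes "finite (vertices G)" "clique G K" "proper_coloring G k c"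
  shows "card K \<le> card (c ` K)" "c ` K \<subseteq> {..<k}"
proof -
  have "inj_on c K" using assms unfolding inj_on_def clique_def proper_coloring_def by metis
  then show "card K \<le> card (c ` K)" by (simp add: card_image)
  show "c ` K \<subseteq> {..<k}"
    using assms unfolding clique_def proper_coloring_def by (meson image_mono order_trans)
qed

lemma clique_le_colors:
  assumes "finite (vertices G)" "clique G K" "proper_coloring G k c"
  shows "card K \<le> k"
  using clique_card_le[OF assms] card_mono[of "{..<k}" "c ` K"] by simp

lemma chromatic_number_eqI:
  assumes "proper_coloring G k c" "finite (vertices G)" "clique G K" "card K = k"
  shows "chromatic_number G = k"
  unfolding chromatic_number_def
proof (rule Least_equality)
  show "\<exists>c. proper_coloring G k c" using assms by blast
qed (use assms clique_le_colors in blast)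

text \<open>Here \<open>k\<close> is any number of colours that suffices, not the chromatic number:
  in a union, one side may be coloured with more colours than it needs. In a join, nonadjacent
  vertices lie on the same side; the other side is recoloured optimally, and the induction
  hypothesis is used with the colours left over. A clique that blocks the separation is then
  extended by a maximum clique of the other side.\<close>

lemma separating_or_twins:
  assumes "cograph G" "u \<in> vertices G" "v \<in> vertices G" "u \<noteq> v" "\<not> adj G u v"
    "proper_coloring G k c"
  shows "(\<exists>c. proper_coloring G k c \<and> c u \<noteq> c v) \<or>
    (\<forall>x. adj G u x \<longleftrightarrow> adj G v x) \<and> (\<exists>K. clique G K \<and> u \<in> K \<and> card K = k)"
  using assms
proof (induction arbitrary: k c u v)
  case (cograph_single w)
  then show ?case by auto
next
  case (cograph_union G H)
  have colG: "proper_coloring G k c" and colH: "proper_coloring H k c"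
    using cograph_union.prems by (auto simp: proper_coloring_def)
  note nG = cograph_edge_subset[OF cograph_union.hyps(1)]
  note nH = cograph_edge_subset[OF cograph_union.hyps(2)]
  note col = proper_coloring_union[OF cograph_union.hyps]
  have disj: "x \<in> vertices G \<Longrightarrow> x \<notin> vertices H" for x using cograph_union.hyps(3) by blast
  consider "u \<in> vertices G" "v \<in> vertices G" | "u \<in> vertices H" "v \<in> vertices H"
    | "u \<in> vertices G \<and> v \<in> vertices H \<or> v \<in> vertices G \<and> u \<in> vertices H"
    using cograph_union.prems by auto
  then show ?case
  proof cases
    case 1
    have "(\<exists>c. proper_coloring G k c \<and> c u \<noteq> c v) \<or>
      (\<forall>x. adj G u x \<longleftrightarrow> adj G v x) \<and> (\<exists>K. clique G K \<and> u \<in> K \<and> card K = k)"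
      using cograph_union.IH(1)[OF 1] cograph_union.prems colG by simp
    then show ?thesis
    proof (elim disjE)
      assume "\<exists>c. proper_coloring G k c \<and> c u \<noteq> c v"
      then obtain d where "proper_coloring G k d" "d u \<noteq> d v" by blast
      then show ?thesis using col[of k d c] colH 1
        by (intro disjI1 exI[of _ "\<lambda>x. if x \<in> vertices G then d x else c x"]) simp
    next
      assume "(\<forall>x. adj G u x \<longleftrightarrow> adj G v x) \<and> (\<exists>K. clique G K \<and> u \<in> K \<and> card K = k)"
      then show ?thesis using 1 disj nH clique_union by (metis adj_union)
    qed
  next
    case 2
    have "(\<exists>c. proper_coloring H k c \<and> c u \<noteq> c v) \<or>
      (\<forall>x. adj H u x \<longleftrightarrow> adj H v x) \<and> (\<exists>K. clique H K \<and> u \<in> K \<and> card K = k)"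
      using cograph_union.IH(2)[OF 2] cograph_union.prems colH by simp
    then show ?thesis
    proof (elim disjE)
      assume "\<exists>c. proper_coloring H k c \<and> c u \<noteq> c v"
      then obtain d where "proper_coloring H k d" "d u \<noteq> d v" by blast
      moreover have "u \<notin> vertices G" "v \<notin> vertices G" using 2 disj by blast+
      ultimately show ?thesis using col[of k c d] colG \<open>proper_coloring H k d\<close> \<open>d u \<noteq> d v\<close>
        by (intro disjI1 exI[of _ "\<lambda>x. if x \<in> vertices G then c x else d x"]) simp
    next
      assume "(\<forall>x. adj H u x \<longleftrightarrow> adj H v x) \<and> (\<exists>K. clique H K \<and> u \<in> K \<and> card K = k)"
      then show ?thesis using 2 disj nG clique_union by (metis adj_union)
    qed
  next
    case 3
    have lt: "c u < k" "c v < k" using cograph_union.prems by (auto simp: proper_coloring_def)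
    show ?thesis
    proof (cases "k = 1")
      case True
      have "\<not> adj (graph_union G H) x y" for x y
      proof
        assume "adj (graph_union G H) x y"
        then have "c x < 1" "c y < 1" "c x \<noteq> c y"
          using colG colH True nG[of x y] nH[of x y] unfolding proper_coloring_def adj_union by blast+
        then show False by simp
      qed
      moreover have "clique (graph_union G H) {u}" using cograph_union.prems by (auto simp: clique_def)
      ultimately show ?thesis using True by (intro disjI2 conjI exI[of _ "{u}"]) auto
    next
      case False
      \<comment> \<open>A second colour exists since \<open>k\<close> is not 1. \<open>d\<close>
        exchanges the colours \<open>c u\<close> and \<open>i\<close>; combining \<open>c\<close> on
        \<open>G\<close> with \<open>d\<close> on \<open>H\<close> separates \<open>u\<close> from
        \<open>v\<close> if \<open>c\<close> does not.\<close>
      define i where "i = (if c v = 0 then 1 else 0 :: nat)"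
      have i: "i < k" "i \<noteq> c v" using False lt by (auto simp: i_def)
      define d where "d x = (if c x = c u then i else if c x = i then c u else c x)" for x
      have d: "proper_coloring H k d" "proper_coloring G k d"
      proof -
        have "d x < k" if "c x < k" for x using that i lt by (auto simp: d_def)
        moreover have "d x \<noteq> d y" if "c x \<noteq> c y" for x y using that by (auto simp: d_def)
        ultimately show "proper_coloring H k d" "proper_coloring G k d"
          using colH colG unfolding proper_coloring_def by (auto simp: image_subset_iff)
      qed
      have "\<exists>c'. proper_coloring (graph_union G H) k c' \<and> c' u \<noteq> c' v"
      proof (cases "c u = c v")
        case True
        then have "d u \<noteq> c v" "c u \<noteq> d v" using i by (auto simp: d_def)
        then show ?thesis
          using 3 disj col[OF colG d(1)]
          by (intro exI[of _ "\<lambda>x. if x \<in> vertices G then c x else d x"]) auto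
      next
        case False
        then show ?thesis using cograph_union.prems by blast
      qed
      then show ?thesis by blast
    qed
  qed
next
  case (cograph_join G H)
  \<comment> \<open>Both sides are variables of this fact, so that the case of \<open>u\<close> and
    \<open>v\<close> in the second side follows by \<open>comm\<close>.\<close>
  have join: "(\<exists>c. proper_coloring (graph_join G H) k c \<and> c u \<noteq> c v) \<or>
    (\<forall>x. adj (graph_join G H) u x \<longleftrightarrow> adj (graph_join G H) v x) \<and>
      (\<exists>K. clique (graph_join G H) K \<and> u \<in> K \<and> card K = k)"
    if GH: "cograph G" "cograph H" "vertices G \<inter> vertices H = {}"
      and IH: "\<And>k c. proper_coloring G k c \<Longrightarrow>
        (\<exists>c. proper_coloring G k c \<and> c u \<noteq> c v) \<or>
        (\<forall>x. adj G u x \<longleftrightarrow> adj G v x) \<and> (\<exists>K. clique G K \<and> u \<in> K \<and> card K = k)"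
      and uv: "u \<in> vertices G" "v \<in> vertices G"
      and c: "proper_coloring (graph_join G H) k c"
    for G H u v
  proof -
    obtain l d L where L: "proper_coloring H l d" "clique H L" "card L = l"
      using cograph_perfect GH(2) by blast
    have fin: "finite (vertices G)" "finite (vertices H)" using cograph_finite[OF GH(1)] cograph_finite[OF GH(2)] by auto
    have cc: "c ` vertices G \<inter> c ` vertices H = {}" "c ` vertices G \<union> c ` vertices H \<subseteq> {..<k}"
      using c by (fastforce simp: proper_coloring_def)+
    have cH: "proper_coloring H k c" using c by (auto simp: proper_coloring_def)
    have LH: "L \<subseteq> vertices H" using L by (auto simp: clique_def)
    \<comment> \<open>The clique \<open>L\<close> forces at least \<open>l\<close> colours on
      \<open>H\<close>. None of them occurs on \<open>G\<close>, which is thus left with at most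
      \<open>k - l\<close>.\<close>
    have "l \<le> card (c ` L)" using clique_card_le[OF fin(2) L(2) cH] L by simp
    also have "\<dots> \<le> card (c ` vertices H)" using fin LH by (intro card_mono) auto
    finally have l: "l \<le> card (c ` vertices H)" .
    have "card (c ` vertices G) + card (c ` vertices H) = card (c ` vertices G \<union> c ` vertices H)"
      using fin cc by (simp add: card_Un_disjoint)
    also have "\<dots> \<le> k" using card_mono[OF _ cc(2)] by simp
    finally have le: "card (c ` vertices G) + card (c ` vertices H) \<le> k" .
    have "\<exists>c'. proper_coloring G (k - l) c'"
    proof (rule proper_coloring_compress[OF fin(1)])
      show "card (c ` vertices G) \<le> k - l" using le l by simp
      show "x \<in> vertices G \<and> y \<in> vertices G \<and> c x \<noteq> c y" if "adj G x y" for x y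
        using cograph_edge_subset[OF GH(1) that] c that unfolding proper_coloring_def adj_join by blast
    qed
    then obtain c' where c': "proper_coloring G (k - l) c'" by blast
    have kl: "k - l + l = k" using l le by simp
    from IH[OF c'] show ?thesis
    proof (elim disjE)
      assume "\<exists>c. proper_coloring G (k - l) c \<and> c u \<noteq> c v"
      then obtain e where "proper_coloring G (k - l) e" "e u \<noteq> e v" by blast
      then show ?thesis using proper_coloring_join[OF GH _ L(1), of "k - l" e] uv kl
        by (intro disjI1 exI[of _ "\<lambda>x. if x \<in> vertices G then e x else k - l + d x"]) simp
    next
      assume *: "(\<forall>x. adj G u x \<longleftrightarrow> adj G v x) \<and> (\<exists>K. clique G K \<and> u \<in> K \<and> card K = k - l)"
      then obtain K where K: "clique G K" "u \<in> K" "card K = k - l" by blast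
      have "K \<subseteq> vertices G" using K by (auto simp: clique_def)
      then have "finite K" "finite L" "K \<inter> L = {}"
        using fin LH GH(3) by (auto intro: finite_subset)
      then have "card (K \<union> L) = k" using K L kl by (simp add: card_Un_disjoint)
      moreover have "adj (graph_join G H) u x \<longleftrightarrow> adj (graph_join G H) v x" for x
        using * uv GH(3) cograph_edge_subset[OF GH(2), of u x] cograph_edge_subset[OF GH(2), of v x]
        by auto
      ultimately show ?thesis using clique_join[OF K(1) L(2)] K(2) by blast
    qed
  qed
  have comm: "graph_join H G = graph_join G H"
    by (auto simp: graph_join_def)
  consider "u \<in> vertices G" "v \<in> vertices G" | "u \<in> vertices H" "v \<in> vertices H"
    using cograph_join.prems by auto
  then show ?case
  proof cases
    case 1
    show ?thesis
      by (rule join) (use 1 cograph_join in auto)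
  next
    case 2
    have nonadj: "\<not> adj H u v" using cograph_join.prems(4) by simp
    have "proper_coloring (graph_join H G) k c" using cograph_join.prems(5) unfolding comm .
    from join[OF cograph_join.hyps(2,1) _ _ 2 this]
      cograph_join.IH(2)[OF 2 cograph_join.prems(3) nonadj]
    show ?thesis using cograph_join.hyps(3) unfolding comm by (simp only: Int_commute)
  qed
qed

text \<open>
  Assumption 4 says that \<open>c\<close> is a Grundy colouring of \<open>X\<close> with respect to the colours that it uses.
  No vertex ordering occurs, so restricting \<open>c\<close> to one side of a join gives such a colouring again.
\<close>

lemma grundy_clique:
  assumes "cograph G" "X \<subseteq> vertices G"
    and "\<And>x y. x \<in> X \<Longrightarrow> y \<in> X \<Longrightarrow> adj G x y \<Longrightarrow> c x \<noteq> (c y :: nat)"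
    and "\<And>x j. x \<in> X \<Longrightarrow> j \<in> c ` X \<Longrightarrow> j < c x \<Longrightarrow> \<exists>y\<in>X. adj G x y \<and> c y = j"
    and "v \<in> X" "\<And>x. x \<in> X \<Longrightarrow> c x \<le> c v"
  shows "\<exists>K. K \<subseteq> X \<and> v \<in> K \<and> clique G K \<and> card K = card (c ` X)"
  using assms
proof (induction arbitrary: X v)
  case (cograph_single w)
  then have "X = {w}" "v = w" by auto
  then show ?case by (auto simp: clique_def intro!: exI[of _ "{w}"])
next
  case (cograph_union G H)
  have *: "\<exists>K. K \<subseteq> X \<and> v \<in> K \<and> clique A K \<and> card K = card (c ` X)"
    if A: "A = G \<or> A = H" and v: "v \<in> vertices A"
      and IH: "\<And>X v. X \<subseteq> vertices A \<Longrightarrow>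
    (\<And>x y. x \<in> X \<Longrightarrow> y \<in> X \<Longrightarrow> adj A x y \<Longrightarrow> c x \<noteq> c y) \<Longrightarrow>
    (\<And>x j. x \<in> X \<Longrightarrow> j \<in> c ` X \<Longrightarrow> j < c x \<Longrightarrow> \<exists>y\<in>X. adj A x y \<and> c y = j) \<Longrightarrow>
    v \<in> X \<Longrightarrow> (\<And>x. x \<in> X \<Longrightarrow> c x \<le> c v) \<Longrightarrow>
    \<exists>K\<subseteq>X. v \<in> K \<and> clique A K \<and> card K = card (c ` X)" for A
  proof -
    have adjA: "adj A x y \<and> y \<in> vertices A" if "adj (graph_union G H) x y" "x \<in> vertices A" for x y
      using that A cograph_union.hyps(3) cograph_edge_subset[OF cograph_union.hyps(1), of x y]
        cograph_edge_subset[OF cograph_union.hyps(2), of x y] by auto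
    have nb: "\<exists>y\<in>X \<inter> vertices A. adj A x y \<and> c y = j" if "x \<in> X \<inter> vertices A" "j \<in> c ` X" "j < c x" for x j
      using cograph_union.prems(3)[of x j] that adjA by blast
    \<comment> \<open>\<open>v\<close> has the largest colour, so its neighbours exhibit all smaller
      ones. They lie on the side of \<open>v\<close>, hence the other side contributes no further
      colour.\<close>
    have im: "c ` (X \<inter> vertices A) = c ` X"
    proof
      show "c ` X \<subseteq> c ` (X \<inter> vertices A)"
      proof
        fix j assume j: "j \<in> c ` X"
        then have "j \<le> c v" using cograph_union.prems(5) by auto
        then show "j \<in> c ` (X \<inter> vertices A)"
          using nb[of v j] j cograph_union.prems(4) v by (cases "j = c v") (simp_all, blast)
      qed
    qed auto
    have "\<exists>K\<subseteq>X \<inter> vertices A. v \<in> K \<and> clique A K \<and> card K = card (c ` (X \<inter> vertices A))"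
    proof (rule IH)
      show "c x \<noteq> c y" if "x \<in> X \<inter> vertices A" "y \<in> X \<inter> vertices A" "adj A x y" for x y
        using cograph_union.prems(2)[of x y] that A by auto
      show "\<exists>y\<in>X \<inter> vertices A. adj A x y \<and> c y = j"
        if "x \<in> X \<inter> vertices A" "j \<in> c ` (X \<inter> vertices A)" "j < c x" for x j
        using nb[of x j] that im by auto
    qed (use v cograph_union.prems in auto)
    then show ?thesis unfolding im by auto
  qed
  have "v \<in> vertices G \<or> v \<in> vertices H" using cograph_union.prems by auto
  then have "\<exists>K. K \<subseteq> X \<and> v \<in> K \<and> (clique G K \<or> clique H K) \<and> card K = card (c ` X)"
  proof
    assume "v \<in> vertices G"
    from *[OF disjI1[OF refl] this cograph_union.IH(1)] show ?thesis by blast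
  next
    assume "v \<in> vertices H"
    from *[OF disjI2[OF refl] this cograph_union.IH(2)] show ?thesis by blast
  qed
  then show ?case using clique_union by blast
next
  case (cograph_join G H)
  have *: "\<exists>K. K \<subseteq> X \<inter> vertices A \<and> v \<in> K \<and> clique A K \<and> card K = card (c ` (X \<inter> vertices A))"
    if A: "A = G \<and> B = H \<or> A = H \<and> B = G"
      and v: "v \<in> X \<inter> vertices A" "\<And>x. x \<in> X \<inter> vertices A \<Longrightarrow> c x \<le> c v"
      and IH: "\<And>X v. X \<subseteq> vertices A \<Longrightarrow>
    (\<And>x y. x \<in> X \<Longrightarrow> y \<in> X \<Longrightarrow> adj A x y \<Longrightarrow> c x \<noteq> c y) \<Longrightarrow>
    (\<And>x j. x \<in> X \<Longrightarrow> j \<in> c ` X \<Longrightarrow> j < c x \<Longrightarrow> \<exists>y\<in>X. adj A x y \<and> c y = j) \<Longrightarrow>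
    v \<in> X \<Longrightarrow> (\<And>x. x \<in> X \<Longrightarrow> c x \<le> c v) \<Longrightarrow>
    \<exists>K\<subseteq>X. v \<in> K \<and> clique A K \<and> card K = card (c ` X)" for A B v
  proof (rule IH)
    have join: "adj (graph_join G H) x y \<longleftrightarrow> adj A x y" if "x \<in> vertices A" "y \<in> vertices A" for x y
      using that A cograph_join.hyps(3) cograph_edge_subset[OF cograph_join.hyps(1), of x y]
        cograph_edge_subset[OF cograph_join.hyps(2), of x y] by auto
    have cross: "adj (graph_join G H) x y" if "x \<in> vertices A" "y \<in> vertices B" for x y
      using that A by auto
    have VX: "X \<subseteq> vertices A \<union> vertices B" using A cograph_join.prems(1) by auto
    show "c x \<noteq> c y" if "x \<in> X \<inter> vertices A" "y \<in> X \<inter> vertices A" "adj A x y" for x y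
      using cograph_join.prems(2)[of x y] that A by auto
    show "\<exists>y\<in>X \<inter> vertices A. adj A x y \<and> c y = j"
      if x: "x \<in> X \<inter> vertices A" and j: "j \<in> c ` (X \<inter> vertices A)" "j < c x" for x j
    proof -
      obtain y where y: "y \<in> X" "adj (graph_join G H) x y" "c y = j"
        using cograph_join.prems(3)[of x j] x j by auto
      obtain z where z: "z \<in> X" "z \<in> vertices A" "c z = j" using j by auto
      \<comment> \<open>A witness on the other side would be adjacent to \<open>z\<close>, which has
        the same colour \<open>j\<close>.\<close>
      have "y \<notin> vertices B"
        using cross[OF z(2), of y] cograph_join.prems(2)[of z y] y z by auto
      then have "y \<in> vertices A" using VX y by auto
      then show ?thesis using y join x by auto
    qed
  qed (use v in auto)
  have *: "\<exists>K. K \<subseteq> X \<and> v \<in> K \<and> clique (graph_join G H) K \<and> card K = card (c ` X)"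
    if A: "A = G \<and> B = H \<or> A = H \<and> B = G" and v: "v \<in> vertices A" for A B
  proof -
    have gA: "cograph A" "cograph B" "vertices A \<inter> vertices B = {}"
      using A cograph_join.hyps by auto
    have "\<exists>K. K \<subseteq> X \<inter> vertices A \<and> v \<in> K \<and> clique A K \<and> card K = card (c ` (X \<inter> vertices A))"
      by (rule *[OF A]) (use A v cograph_join in \<open>auto\<close>)
    then obtain K where K: "K \<subseteq> X \<inter> vertices A" "v \<in> K" "clique A K"
      "card K = card (c ` (X \<inter> vertices A))" by blast
    have fin: "finite (X \<inter> vertices A)" "finite (X \<inter> vertices B)"
      using cograph_finite[OF gA(1)] cograph_finite[OF gA(2)] by auto
    \<comment> \<open>No vertex is prescribed on this side; any vertex of largest colour there makes
      the induction hypothesis applicable.\<close>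
    have "\<exists>L. L \<subseteq> X \<inter> vertices B \<and> clique B L \<and> card L = card (c ` (X \<inter> vertices B))"
    proof (cases "X \<inter> vertices B = {}")
      case True
      then show ?thesis by (auto simp: clique_def)
    next
      case False
      then obtain w where w: "w \<in> X \<inter> vertices B" "\<And>x. x \<in> X \<inter> vertices B \<Longrightarrow> c x \<le> c w"
        using fin(2) Max_in[of "c ` (X \<inter> vertices B)"] Max_ge[of "c ` (X \<inter> vertices B)"] 
        by (smt (verit) finite_imageI imageE imageI image_is_empty)
      have "\<exists>L. L \<subseteq> X \<inter> vertices B \<and> w \<in> L \<and> clique B L \<and> card L = card (c ` (X \<inter> vertices B))"
        by (rule *[of B A]) (use A w cograph_join in auto)
      then show ?thesis by blast
    qed
    then obtain L where L: "L \<subseteq> X \<inter> vertices B" "clique B L" "card L = card (c ` (X \<inter> vertices B))"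
      by blast
    have "clique (graph_join G H) (K \<union> L)"
      using A clique_join[of A K B L] clique_join[of B L A K] K L by (auto simp: Un_commute)
    moreover have "card (K \<union> L) = card K + card L"
      using K L gA(3) finite_subset[OF _ fin(1)] finite_subset[OF _ fin(2)]
      by (intro card_Un_disjoint) auto
    moreover have "card (c ` X) = card (c ` (X \<inter> vertices A)) + card (c ` (X \<inter> vertices B))"
    proof -
      have X: "X = (X \<inter> vertices A) \<union> (X \<inter> vertices B)" using A cograph_join.prems(1) by auto
      have "c ` (X \<inter> vertices A) \<inter> c ` (X \<inter> vertices B) = {}"
      proof -
        have "c x \<noteq> c y" if "x \<in> X \<inter> vertices A" "y \<in> X \<inter> vertices B" for x y
          using cograph_join.prems(2)[of x y] that A by auto
        then show ?thesis by blast
      qed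
      then show ?thesis using fin X by (metis card_Un_disjoint finite_imageI image_Un)
    qed
    ultimately show ?thesis using K L by (intro exI[of _ "K \<union> L"]) auto
  qed
  have "v \<in> vertices G \<or> v \<in> vertices H" using cograph_join.prems by auto
  then show ?case using *[of G H] *[of H G] by blast
qed

text \<open>Adding \<open>uv\<close> keeps the chromatic number iff some optimal colouring separates
  \<open>u\<close> and \<open>v\<close>. Nonadjacency is not demanded of the pair on the right,
  because equal neighbourhoods already exclude an edge between them. Maximality of \<open>K\<close>
  is stated by comparing cliques, which is the form that peeling decides.\<close>

lemma chi_unfrozen_iff:
  assumes G: "cograph G"
  shows "chi_unfrozen G \<longleftrightarrow>
    \<not> (\<exists>u v K. u \<in> vertices G \<and> v \<in> vertices G \<and> u \<noteq> v \<and> (\<forall>x. adj G u x \<longleftrightarrow> adj G v x) \<and>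
       clique G K \<and> u \<in> K \<and> (\<forall>L. clique G L \<longrightarrow> card L \<le> card K))"
proof -
  obtain k c M where M: "proper_coloring G k c" "clique G M" "card M = k"
    using cograph_perfect[OF G] by blast
  have fin: "finite (vertices G)" using cograph_finite[OF G] .
  have chi: "chromatic_number G = k" using chromatic_number_eqI M fin by blast
  have add: "proper_coloring (add_edge G {u, v}) j d \<longleftrightarrow> proper_coloring G j d \<and> d u \<noteq> d v" for u v j d
    by (auto simp: proper_coloring_def add_edge_def doubleton_eq_iff)
  have max: "card L \<le> k" if "clique G L" for L using clique_le_colors fin that M by blast
  have unfrozen_edge: "chromatic_number (add_edge G {u, v}) = k \<longleftrightarrow>
      (\<exists>d. proper_coloring G k d \<and> d u \<noteq> d v)" if "u \<noteq> v" "v \<in> vertices G" for u v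
  proof
    assume k: "chromatic_number (add_edge G {u, v}) = k"
    \<comment> \<open>A fresh colour for \<open>u\<close> shows that colourings of the new graph
      exist; otherwise \<open>LEAST\<close> would carry no information.\<close>
    have "\<exists>j d. proper_coloring (add_edge G {u, v}) j d"
    proof -
      have "\<exists>c'. proper_coloring G (Suc k) c' \<and> c' u \<noteq> c' v"
      proof (cases "c u = c v")
        case True
        have "proper_coloring G (Suc k) (c(u := k))"
          unfolding proper_coloring_def
        proof (intro conjI allI impI)
          show "(c(u := k)) ` vertices G \<subseteq> {..<Suc k}"
            using M(1) by (auto simp: proper_coloring_def less_Suc_eq)
          fix x y assume xy: "adj G x y"
          then have "x \<noteq> y" "c x < k" "c y < k" "c x \<noteq> c y"
            using M(1) cograph_irrefl[OF G] cograph_edge_subset[OF G xy]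
            by (auto simp: proper_coloring_def)
          then show "(c(u := k)) x \<noteq> (c(u := k)) y" by auto
        qed
        moreover have "c v < k" using M(1) that by (auto simp: proper_coloring_def)
        ultimately show ?thesis using that by (intro exI[of _ "c(u := k)"]) auto
      qed (use M proper_coloring_mono in \<open>meson le_SucI order_refl\<close>)
      then show ?thesis using add by blast
    qed
    then show "\<exists>d. proper_coloring G k d \<and> d u \<noteq> d v"
      using k LeastI_ex[of "\<lambda>j. \<exists>d. proper_coloring (add_edge G {u, v}) j d"]
      unfolding chromatic_number_def add by simp
  next
    assume "\<exists>d. proper_coloring G k d \<and> d u \<noteq> d v"
    then show "chromatic_number (add_edge G {u, v}) = k"
      unfolding chromatic_number_def
      using clique_le_colors[OF fin M(2)] M(3) 
      by (intro Least_equality) (auto simp: add)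
  qed
  have twins: "(\<exists>d. proper_coloring G k d \<and> d u \<noteq> d v) \<longleftrightarrow>
      \<not> ((\<forall>x. adj G u x \<longleftrightarrow> adj G v x) \<and> (\<exists>K. clique G K \<and> u \<in> K \<and> card K = k))"
    if uv: "u \<in> vertices G" "v \<in> vertices G" "u \<noteq> v" "\<not> adj G u v" for u v
  proof
    assume "\<exists>d. proper_coloring G k d \<and> d u \<noteq> d v"
    then obtain d where d: "proper_coloring G k d" "d u \<noteq> d v" by blast
    show "\<not> ((\<forall>x. adj G u x \<longleftrightarrow> adj G v x) \<and> (\<exists>K. clique G K \<and> u \<in> K \<and> card K = k))"
    proof
      assume "(\<forall>x. adj G u x \<longleftrightarrow> adj G v x) \<and> (\<exists>K. clique G K \<and> u \<in> K \<and> card K = k)"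
      then obtain K where K: "\<And>x. adj G u x \<longleftrightarrow> adj G v x" "clique G K" "u \<in> K" "card K = k"
        by blast
      have le: "k \<le> card (d ` K)" "d ` K \<subseteq> {..<k}"
        using clique_card_le[OF fin K(2) d(1)] unfolding K(4) by blast+
      \<comment> \<open>The clique \<open>K\<close> uses all \<open>k\<close> colours, but
        \<open>v\<close> is adjacent to every vertex of \<open>K\<close> except \<open>u\<close>,
        and \<open>d\<close> separates it from \<open>u\<close>.\<close>
      have "d v \<notin> d ` K"
      proof
        assume "d v \<in> d ` K"
        then obtain x where x: "x \<in> K" "d v = d x" by blast
        then have "u \<noteq> x" using d by auto
        then have "adj G u x" using K(2,3) x(1) by (simp add: clique_def)
        then have "adj G v x" by (rule K(1)[THEN iffD1])
        then have "d v \<noteq> d x" using d(1) by (simp add: proper_coloring_def)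
        then show False using x(2) by simp
      qed
      moreover have "d v < k" using d uv by (auto simp: proper_coloring_def)
      ultimately have "d ` K \<subset> {..<k}" using le by auto
      then have "card (d ` K) < k" using psubset_card_mono[of "{..<k}"] by simp
      then show False using le by simp
    qed
  next
    assume *: "\<not> ((\<forall>x. adj G u x \<longleftrightarrow> adj G v x) \<and> (\<exists>K. clique G K \<and> u \<in> K \<and> card K = k))"
    show "\<exists>d. proper_coloring G k d \<and> d u \<noteq> d v"
      by (rule disjE[OF separating_or_twins[OF G uv M(1)]]) (assumption, erule notE[OF *])
  qed
  define separable where "separable u v \<longleftrightarrow> (\<exists>d. proper_coloring G k d \<and> d u \<noteq> d v)" for u v
  define twin where "twin u v \<longleftrightarrow> (\<forall>x. adj G u x \<longleftrightarrow> adj G v x)" for u v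
  define critical where "critical u \<longleftrightarrow> (\<exists>K. clique G K \<and> u \<in> K \<and> card K = k)" for u
  have separable: "separable u v \<longleftrightarrow> \<not> (twin u v \<and> critical u)"
    if "u \<in> vertices G" "v \<in> vertices G" "u \<noteq> v" "\<not> adj G u v" for u v
    using twins[OF that] unfolding separable_def twin_def critical_def .
  have twin_nonadj: "\<not> adj G u v" if "twin u v" for u v
    using that cograph_irrefl[OF G, of v] by (simp add: twin_def)
  have critical: "critical u \<longleftrightarrow> (\<exists>K. clique G K \<and> u \<in> K \<and> (\<forall>L. clique G L \<longrightarrow> card L \<le> card K))" for u
  proof
    assume "critical u"
    then show "\<exists>K. clique G K \<and> u \<in> K \<and> (\<forall>L. clique G L \<longrightarrow> card L \<le> card K)"
      using max by (auto simp: critical_def)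
  next
    assume "\<exists>K. clique G K \<and> u \<in> K \<and> (\<forall>L. clique G L \<longrightarrow> card L \<le> card K)"
    then obtain K where "clique G K" "u \<in> K" "card M \<le> card K" using M(2) by blast
    then show "critical u" using max[of K] M(3) unfolding critical_def by (intro exI[of _ K]) simp
  qed
  have "chi_unfrozen G \<longleftrightarrow> (\<forall>u v. u \<in> vertices G \<and> v \<in> vertices G \<and> u \<noteq> v \<and> \<not> adj G u v \<longrightarrow>
      separable u v)"
  proof
    assume unfrozen: "chi_unfrozen G"
    show "\<forall>u v. u \<in> vertices G \<and> v \<in> vertices G \<and> u \<noteq> v \<and> \<not> adj G u v \<longrightarrow>
      separable u v"
    proof (intro allI impI)
      fix u v assume uv: "u \<in> vertices G \<and> v \<in> vertices G \<and> u \<noteq> v \<and> \<not> adj G u v"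
      then have "{u, v} \<in> nonedges G" unfolding nonedges_def by blast
      then have "chromatic_number (add_edge G {u, v}) = k"
        using unfrozen unfolding chi_unfrozen_def chi by simp
      then show "separable u v"
        using unfrozen_edge[of u v] uv by (simp add: separable_def)
    qed
  next
    assume *: "\<forall>u v. u \<in> vertices G \<and> v \<in> vertices G \<and> u \<noteq> v \<and> \<not> adj G u v \<longrightarrow>
      separable u v"
    show "chi_unfrozen G"
      unfolding chi_unfrozen_def chi
    proof
      fix e assume "e \<in> nonedges G"
      then obtain u v where e: "e = {u, v}" and uv: "u \<in> vertices G" "v \<in> vertices G" "u \<noteq> v" "\<not> adj G u v"
        unfolding nonedges_def by blast
      then show "chromatic_number (add_edge G e) = k"
        using * unfrozen_edge[of u v] unfolding e separable_def by simp
    qed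
  qed
  also have "\<dots> \<longleftrightarrow> \<not> (\<exists>u v. u \<in> vertices G \<and> v \<in> vertices G \<and> u \<noteq> v \<and> twin u v \<and> critical u)"
    using separable twin_nonadj by blast
  finally show ?thesis by (simp add: twin_def critical)
qed

text \<open>\<open>M R\<close> can be any maximal independent subset of \<open>R\<close> that avoids
  \<open>u\<close> while neighbours of \<open>u\<close> are left. The iteration is stationary once
  \<open>u\<close> is gone, so a loop of fixed length replaces a stopping condition. If nothing is
  left, the rounds colour every clique injectively, so none exceeds the clique through
  \<open>u\<close> that \<open>grundy_clique\<close> provides.\<close>

lemma peeling_decides_max_clique:
  fixes G :: "'a graph" and M :: "'a set \<Rightarrow> 'a set"
  assumes G: "cograph G" and u: "u \<in> vertices G"
    and sub: "\<And>R. R \<subseteq> vertices G \<Longrightarrow> M R \<subseteq> R"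
    and indep: "\<And>R x y. R \<subseteq> vertices G \<Longrightarrow> x \<in> M R \<Longrightarrow> y \<in> M R \<Longrightarrow> \<not> adj G x y"
    and maximal: "\<And>R x. R \<subseteq> vertices G \<Longrightarrow> x \<in> R \<Longrightarrow> x \<notin> M R \<Longrightarrow> \<exists>y\<in>M R. adj G x y"
    and last: "\<And>R x. R \<subseteq> vertices G \<Longrightarrow> u \<in> M R \<Longrightarrow> x \<in> R \<Longrightarrow> \<not> adj G u x"
  shows "((\<lambda>R. if u \<in> R then R - M R else R) ^^ card (vertices G)) (vertices G) = {} \<longleftrightarrow>
    (\<exists>K. clique G K \<and> u \<in> K \<and> (\<forall>L. clique G L \<longrightarrow> card L \<le> card K))"
proof -
  let ?V = "vertices G"
  define R where "R t = ((\<lambda>R. if u \<in> R then R - M R else R) ^^ t) ?V" for t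
  have R0: "R 0 = ?V" and RS: "R (Suc t) = (if u \<in> R t then R t - M (R t) else R t)" for t
    by (simp_all add: R_def)
  have fin: "finite ?V" using cograph_finite[OF G] .
  have mono: "R t \<subseteq> R s" if "s \<le> t" for s t
    using that by (induction t rule: dec_induct) (auto simp: RS)
  have RV: "R t \<subseteq> ?V" for t using mono[of 0 t] R0 by simp
  have finR: "finite (R t)" for t using finite_subset[OF RV fin] .
  \<comment> \<open>While \<open>u\<close> is present, every round removes at least one vertex, so
    \<open>card ?V\<close> rounds are enough to remove \<open>u\<close>.\<close>
  have "card (R t) + t \<le> card ?V" if "u \<in> R t \<or> t = 0" for t
    using that
  proof (induction t)
    case (Suc t)
    then have ut: "u \<in> R t" using mono[of t "Suc t"] by auto
    have "M (R t) \<noteq> {}" using maximal[OF RV ut] by blast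
    then have "R (Suc t) \<subset> R t" using ut sub[OF RV, of t] by (auto simp: RS)
    then have "card (R (Suc t)) < card (R t)" by (rule psubset_card_mono[OF finR])
    then show ?case using Suc.IH ut by simp
  qed (simp add: R0)
  then have un: "u \<notin> R (card ?V)"
    using finR[of "card ?V"] by (metis add_le_same_cancel2 card_0_eq empty_iff le_zero_eq)
  define T where "T = (LEAST t. u \<notin> R t)"
  have uT: "u \<notin> R T" unfolding T_def by (rule LeastI[of _ "card ?V"]) (rule un)
  have Tn: "T \<le> card ?V" unfolding T_def by (rule Least_le) (rule un)
  have ult: "u \<in> R t" if "t < T" for t using not_less_Least[of t "\<lambda>t. u \<notin> R t"] that by (simp add: T_def)
  have "T \<noteq> 0" using uT u R0 by metis
  then obtain T' where T': "T = Suc T'" by (cases T) auto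
  have Rn: "R t = R T" if "T \<le> t" for t
    using that
  proof (induction t rule: dec_induct)
    case (step t)
    then show ?case using uT by (simp add: RS)
  qed simp
  \<comment> \<open>\<open>c x\<close> is the round in which \<open>x\<close> is peeled. The
    disjunct \<open>t = T\<close> gives all vertices that outlive \<open>u\<close> the common value
    \<open>T\<close>.\<close>
  define c where "c x = (LEAST t. t = T \<or> x \<notin> R (Suc t))" for x
  have cT: "c x \<le> T" for x unfolding c_def by (rule Least_le) simp
  have c_in: "x \<in> R (c x)" if "x \<in> ?V" for x
  proof (cases "c x")
    case (Suc t)
    then have "\<not> (t = T \<or> x \<notin> R (Suc t))"
      using not_less_Least[of t "\<lambda>t. t = T \<or> x \<notin> R (Suc t)"] by (simp add: c_def)
    then show ?thesis using Suc by simp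
  qed (use that R0 in simp)
  have c_mis: "x \<in> M (R (c x))" if "x \<in> ?V" "c x < T" for x
  proof -
    have "c x = T \<or> x \<notin> R (Suc (c x))"
      unfolding c_def by (rule LeastI[of "\<lambda>t. t = T \<or> x \<notin> R (Suc t)" T]) simp
    then show ?thesis using that c_in[OF that(1)] ult[OF that(2)] by (auto simp: RS)
  qed
  have c_eq: "c y = j" if "y \<in> M (R j)" "j < T" for y j
    unfolding c_def
  proof (rule Least_equality)
    show "j = T \<or> y \<notin> R (Suc j)" using that ult by (simp add: RS)
    fix i assume i: "i = T \<or> y \<notin> R (Suc i)"
    show "j \<le> i"
    proof (rule ccontr)
      assume "\<not> j \<le> i"
      then have "y \<in> R (Suc i)" using mono[of "Suc i" j] that(1) sub[OF RV] by fastforce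
      then show False using i that(2) \<open>\<not> j \<le> i\<close> by simp
    qed
  qed
  have nbr: "\<exists>y\<in>?V. adj G x y \<and> c y = j" if "x \<in> ?V" "j < c x" for x j
  proof -
    have j: "j < T" using that cT[of x] by simp
    have "x \<in> R (Suc j)" using c_in[OF that(1)] mono[of "Suc j" "c x"] that(2) by auto
    then have "x \<in> R j" "x \<notin> M (R j)" using ult[OF j] by (auto simp: RS)
    then obtain y where "y \<in> M (R j)" "adj G x y" using maximal[OF RV] by blast
    then show ?thesis using c_eq[OF _ j] sub[OF RV] RV by blast
  qed
  have proper: "c x \<noteq> c y" if "x \<in> ?V" "y \<in> ?V" "adj G x y" "c x < T" for x y
  proof
    assume eq: "c x = c y"
    have "x \<in> M (R (c x))" "y \<in> M (R (c x))"
      using c_mis[OF that(1,4)] c_mis[OF that(2)] that(4) eq by auto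
    then show False using indep[OF RV] that(3) by blast
  qed
  have inj: "card L \<le> card (c ` L)" if "clique G L" "\<And>x. x \<in> L \<Longrightarrow> c x < T" for L
  proof -
    have "inj_on c L"
    proof (rule inj_onI, rule ccontr)
      fix x y assume xy: "x \<in> L" "y \<in> L" "c x = c y" "x \<noteq> y"
      then have "adj G x y" "x \<in> ?V" "y \<in> ?V" using that(1) unfolding clique_def by auto
      then show False using proper[of x y] that(2) xy by auto
    qed
    then show ?thesis by (simp add: card_image)
  qed
  have cu: "c u = T'" "u \<in> M (R T')"
  proof -
    show "u \<in> M (R T')" using uT ult[of T'] by (simp add: T' RS split: if_splits)
    then show "c u = T'" using c_eq T' by simp
  qed
  have final: "((\<lambda>R. if u \<in> R then R - M R else R) ^^ card ?V) ?V = R T"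
    using Rn[OF Tn] by (simp add: R_def)
  show ?thesis
    unfolding final
  proof
    assume empty: "R T = {}"
    have lt: "c x < T" if "x \<in> ?V" for x
      using c_in[OF that] cT[of x] empty by (cases "c x = T") auto
    have "\<exists>K. K \<subseteq> ?V \<and> u \<in> K \<and> clique G K \<and> card K = card (c ` ?V)"
    proof (rule grundy_clique[OF G])
      show "c x \<le> c u" if "x \<in> ?V" for x using lt[OF that] cu T' by simp
      show "c x \<noteq> c y" if "x \<in> ?V" "y \<in> ?V" "adj G x y" for x y using proper[OF that] lt that by simp
    qed (use nbr u in auto)
    then obtain K where K: "u \<in> K" "clique G K" "card K = card (c ` ?V)" by blast
    have "card L \<le> card K" if L: "clique G L" for L
    proof -
      have LV: "L \<subseteq> ?V" using L by (simp add: clique_def)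
      have "card L \<le> card (c ` L)" by (rule inj[OF L]) (use LV lt in auto)
      also have "\<dots> \<le> card (c ` ?V)" using LV fin by (intro card_mono) auto
      finally show ?thesis using K by simp
    qed
    then show "\<exists>K. clique G K \<and> u \<in> K \<and> (\<forall>L. clique G L \<longrightarrow> card L \<le> card K)" using K by blast
  next
    assume ex: "\<exists>K. clique G K \<and> u \<in> K \<and> (\<forall>L. clique G L \<longrightarrow> card L \<le> card K)"
    show "R T = {}"
    proof (rule ccontr)
      assume "R T \<noteq> {}"
      then obtain x where x: "x \<in> R T" by blast
      have xV: "x \<in> ?V" using x RV by blast
      have cx: "c x = T"
      proof (rule ccontr)
        assume "c x \<noteq> T"
        then have lt: "c x < T" using cT[of x] by simp
        from c_mis[OF xV this] have "x \<notin> R (Suc (c x))" using ult[OF lt] by (simp add: RS)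
        then show False using mono[of "Suc (c x)" T] lt x by auto
      qed
      define X where "X = insert x {y\<in>?V. c y < T}"
      have "\<exists>K. K \<subseteq> X \<and> x \<in> K \<and> clique G K \<and> card K = card (c ` X)"
      proof (rule grundy_clique[OF G])
        show "X \<subseteq> ?V" using xV by (auto simp: X_def)
        show "x \<in> X" by (simp add: X_def)
        show "c y \<le> c x" for y using cT[of y] cx by simp
        show "c y \<noteq> c z" if yz: "y \<in> X" "z \<in> X" "adj G y z" for y z
        proof (cases "c y < T")
          case True
          then show ?thesis using proper[of y z] yz xV by (auto simp: X_def)
        next
          case False
          then have y: "y = x" using yz by (auto simp: X_def)
          then have "z \<noteq> x" using cograph_irrefl[OF G, of x] yz by auto
          then show ?thesis using yz y cx by (auto simp: X_def)
        qed
        show "\<exists>z\<in>X. adj G y z \<and> c z = j" if y: "y \<in> X" "j < c y" for y j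
        proof -
          have "y \<in> ?V" "j < T" using y xV cT[of y] by (auto simp: X_def)
          then show ?thesis using nbr[of y j] y(2) by (auto simp: X_def)
        qed
      qed
      then obtain K where K: "clique G K" "card K = card (c ` X)" by blast
      have "{..T} \<subseteq> c ` X"
      proof
        fix j assume "j \<in> {..T}"
        then show "j \<in> c ` X"
          using nbr[OF xV, of j] cx by (cases "j = T") (auto simp: X_def image_iff)
      qed
      moreover have "finite X" using fin by (simp add: X_def)
      ultimately have "card {..T} \<le> card (c ` X)" by (intro card_mono) auto
      then have KT: "T < card K" using K by simp
      obtain L where L: "clique G L" "u \<in> L" "card K \<le> card L" using ex K(1) by blast
      \<comment> \<open>The neighbours of \<open>u\<close> are gone when \<open>u\<close> is taken.
        A clique through \<open>u\<close> thus lives in the first \<open>T\<close> colours, while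
        \<open>K\<close> has more than \<open>T\<close> vertices.\<close>
      have lt: "c y < T" if "y \<in> L" for y
      proof (cases "y = u")
        case True
        then show ?thesis using cu T' by simp
      next
        case False
        then have "adj G u y" "y \<in> ?V" using L that by (auto simp: clique_def)
        then have "y \<notin> R T'" using last[OF RV cu(2)] by blast
        then have "\<not> T' \<le> c y" using mono[of T' "c y"] c_in[OF \<open>y \<in> ?V\<close>] by blast
        then show ?thesis using T' by simp
      qed
      have "card L \<le> card (c ` L)" by (rule inj[OF L(1) lt])
      also have "\<dots> \<le> card {..<T}" using lt by (intro card_mono) auto
      finally show False using KT L(3) by simp
    qed
  qed
qed

section \<open>The decision procedure\<close>

text \<open>
  A cell \<open>(u, w, s, r, i)\<close> stores whether its vertex is the tested one (\<open>u\<close>), the one whose matrix row is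
  being read (\<open>w\<close>), a neighbour of the tested one (\<open>s\<close>), not yet peeled off (\<open>r\<close>), and in the current
  independent set (\<open>i\<close>). The memory is \<open>(cu, cw, h, a, t1, t2, z)\<close>: the carries that shift the marks \<open>u\<close> and
  \<open>w\<close> by one cell, a scratch bit, whether peeling continues, whether at least one and at least two
  rows agree with the row of the tested vertex, and the result.
\<close>

type_synonym cell = "bool \<times> bool \<times> bool \<times> bool \<times> bool"
type_synonym mem = "bool \<times> bool \<times> bool \<times> bool \<times> bool \<times> bool \<times> bool"

text \<open>The mark \<open>w\<close> starts in the carry \<open>cw\<close>, ahead of cell 0.
  Shifting it once per row therefore puts it on cell \<open>j\<close> while row \<open>j\<close> is
  processed.\<close>

definition first_row :: "(mem, cell) hl" where
  "first_row =
     Upd (\<lambda>(cu, cw, h, a, t1, t2, z). (cu, True, h, a, t1, t2, z)) ;;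
     Pass False (\<lambda>m (u, w, s, r, i) _. (m, (u, False, s, r, i))) ;;
     Rewind"

text \<open>The pass that shifts \<open>u\<close> also wipes the flags left by the previous
  vertex.\<close>

definition select_vertex :: "(mem, cell) hl" where
  "select_vertex =
     Upd (\<lambda>(cu, cw, h, a, t1, t2, z). (cu, cw, h, a, False, False, z)) ;;
     Pass False (\<lambda>(cu, m) (u, w, s, r, i) _. ((u, m), (cu, False, False, True, False)))"

text \<open>Rows can only be read one after the other. The row to be stored is recognised when the
  shifted mark \<open>w\<close> meets \<open>u\<close>; \<open>h\<close> keeps this for the pass
  that reads the bits.\<close>

definition load_row :: "(mem, cell) hl" where
  "load_row =
     Upd (\<lambda>(cu, cw, h, a, t1, t2, z). (cu, cw, False, a, t1, t2, z)) ;;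
     Pass False (\<lambda>(cu, cw, h, m) (u, w, s, r, i) _. ((cu, w, h \<or> cw \<and> u, m), (u, cw, s, r, i))) ;;
     Pass True (\<lambda>(cu, cw, h, m) (u, w, s, r, i) b. ((cu, cw, h, m), (u, w, if h then b else s, r, i)))"

text \<open>\<open>h\<close> records a conflict with the current set. Adding the vertex takes a
  second pass, since its cell may precede that of the neighbour which forbids it.\<close>

definition try_row :: "(bool \<Rightarrow> bool \<Rightarrow> bool) \<Rightarrow> (mem, cell) hl" where
  "try_row sel =
     Upd (\<lambda>(cu, cw, h, a, t1, t2, z). (cu, cw, False, a, t1, t2, z)) ;;
     Pass True (\<lambda>(cu, cw, h, m) (u, w, s, r, i) b. ((cu, w, h \<or> i \<and> b, m), (u, cw, s, r, i))) ;;
     Pass False (\<lambda>(cu, cw, h, a, m) (u, w, s, r, i) b.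
       ((cu, cw, h, a, m), (u, w, s, r, i \<or> w \<and> sel s r \<and> \<not> h \<and> a)))"

text \<open>Once the tested vertex is gone, \<open>a\<close> is False and blocks every choice, so
  that further rounds leave the remaining set unchanged.\<close>

definition peel :: "(mem, cell) hl" where
  "peel =
     Upd (\<lambda>(cu, cw, h, a, t1, t2, z). (cu, cw, h, False, t1, t2, z)) ;;
     Pass False (\<lambda>(cu, cw, h, a, m) (u, w, s, r, i) _. ((cu, cw, h, a \<or> u \<and> r, m), (u, w, s, r, i))) ;;
     first_row ;; For (try_row (\<and>)) ;; first_row ;; For (try_row (\<lambda>s r. r)) ;;
     Pass False (\<lambda>m (u, w, s, r, i) _. (m, (u, w, s, r \<and> \<not> i, False)))"

text \<open>The row of the tested vertex always agrees with itself; counting agreements up to two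
  makes it unnecessary to recognise that row.\<close>

definition compare_row :: "(mem, cell) hl" where
  "compare_row =
     Upd (\<lambda>(cu, cw, h, a, t1, t2, z). (cu, cw, False, a, t1, t2, z)) ;;
     Pass True (\<lambda>(cu, cw, h, m) (u, w, s, r, i) b. ((cu, cw, h \<or> b \<noteq> s, m), (u, w, s, r, i))) ;;
     Upd (\<lambda>(cu, cw, h, a, t1, t2, z). (cu, cw, h, a, t1 \<or> \<not> h, t2 \<or> t1 \<and> \<not> h, z))"

text \<open>After the peeling, \<open>a\<close> is reused to record whether any vertex is left.
  \<open>z\<close> accumulates the finding of a critical pair over all tested vertices.\<close>

definition test_vertex :: "(mem, cell) hl" where
  "test_vertex =
     select_vertex ;; first_row ;; For load_row ;; For peel ;; first_row ;; For compare_row ;;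
     Upd (\<lambda>(cu, cw, h, a, t1, t2, z). (cu, cw, h, False, t1, t2, z)) ;;
     Pass False (\<lambda>(cu, cw, h, a, m) (u, w, s, r, i) _. ((cu, cw, h, a \<or> r, m), (u, w, s, r, i))) ;;
     Upd (\<lambda>(cu, cw, h, a, t1, t2, z). (cu, cw, h, a, t1, t2, z \<or> t2 \<and> \<not> a))"

section \<open>Running the scan programs on the matrix of a co-graph\<close>

context
  fixes G :: "'a graph" and vs :: "'a list" and inp :: "nat \<Rightarrow> bool"
  assumes G: "cograph G" and vs: "distinct vs" "set vs = vertices G"
    and inp: "\<And>w x. w < length vs \<Longrightarrow> x < length vs \<Longrightarrow>
      inp (w * length vs + x) \<longleftrightarrow> adj G (vs ! w) (vs ! x)"
begin

abbreviation "n \<equiv> length vs"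
abbreviation "run \<equiv> hexec n inp"

text \<open>The moving marks are predicates on positions, whereas the other flags are sets of
  vertices, to which facts about the graph apply directly.\<close>

definition data :: "(nat \<Rightarrow> bool) \<Rightarrow> (nat \<Rightarrow> bool) \<Rightarrow> 'a set \<Rightarrow> 'a set \<Rightarrow> 'a set \<Rightarrow> nat \<Rightarrow> cell" where
  "data U W S R I = cells n (False, False, False, False, False)
     (\<lambda>x. (U x, W x, vs ! x \<in> S, vs ! x \<in> R, vs ! x \<in> I))"

lemma ex_vertex: "(\<exists>x<n. Q (vs ! x)) \<longleftrightarrow> (\<exists>v\<in>vertices G. Q v)"
  using vs(2) by (metis in_set_conv_nth)

lemma nth_vertex: "i < n \<Longrightarrow> vs ! i \<in> vertices G"
  using vs(2) nth_mem by blast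

lemma vertex_eq: "i < n \<Longrightarrow> j < n \<Longrightarrow> vs ! i = vs ! j \<longleftrightarrow> i = j"
  using vs(1) nth_eq_iff_index_eq by blast

lemma run_Pass:
  assumes "\<And>x. x < n \<Longrightarrow> f (M x) (U x, W x, vs ! x \<in> S, vs ! x \<in> R, vs ! x \<in> I)
      (inp (if b then p + x else p)) =
      (M (Suc x), (U' x, W' x, vs ! x \<in> S', vs ! x \<in> R', vs ! x \<in> I'))"
    and "m = M 0" "m' = M n" "p' = (if b then p + n else p)"
  shows "run (Pass b f) (m, data U W S R I, p) = (m', data U' W' S' R' I', p')"
  unfolding data_def assms(2-4) by (rule hexec_Pass) (rule assms(1))

text \<open>\<open>Suc x = 0\<close> holds for no \<open>x\<close>; it is the instance at row 0 of
  the invariant \<open>Suc x = w\<close>, by which the mark stands one cell behind the row that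
  comes next.\<close>

lemma run_first_row:
  "run first_row ((cu, cw, h, a, t1, t2, z), data U W S R I, p) =
    ((cu, True, h, a, t1, t2, z), data U (\<lambda>x. Suc x = 0) S R I, 0)"
proof -
  have "run (Pass False (\<lambda>m (u, w, s, r, i) _. (m, (u, False, s, r, i))))
      ((cu, True, h, a, t1, t2, z), data U W S R I, p) =
      ((cu, True, h, a, t1, t2, z), data U (\<lambda>x. Suc x = 0) S R I, p)"
    by (rule run_Pass) auto
  then show ?thesis unfolding first_row_def by (simp del: hexec.simps(2))
qed

lemma run_select_vertex:
  assumes "k < n"
  shows "run select_vertex ((k = 0, cw, h, a, t1, t2, z), data (\<lambda>x. Suc x = k) W S R I, p) =
    ((False, cw, h, a, False, False, z), data (\<lambda>x. x = k) (\<lambda>_. False) {} (vertices G) {}, p)"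
proof -
  have "run (Pass False (\<lambda>(cu, m) (u, w, s, r, i) _. ((u, m), (cu, False, False, True, False))))
      ((k = 0, cw, h, a, False, False, z), data (\<lambda>x. Suc x = k) W S R I, p) =
     ((False, cw, h, a, False, False, z), data (\<lambda>x. x = k) (\<lambda>_. False) {} (vertices G) {}, p)"
    by (rule run_Pass[where M = "\<lambda>i. (i = k, cw, h, a, False, False, z)"])
      (use assms nth_vertex in \<open>auto simp del: length_greater_0_conv\<close>)
  then show ?thesis
    unfolding select_vertex_def by (simp del: hexec.simps(2))
qed

lemma run_load_row:
  assumes "k < n" "w < n"
  shows "run load_row ((cu, w = 0, h, m), data (\<lambda>x. x = k) (\<lambda>x. Suc x = w) S R I, w * n) =
    ((cu, False, w = k, m), data (\<lambda>x. x = k) (\<lambda>x. x = w)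
       (if w = k then {v. adj G (vs ! k) v} else S) R I, Suc w * n)"
proof -
  obtain a t1 t2 z where m: "m = (a, t1, t2, z)" by (cases m)
  have 1: "run (Pass False (\<lambda>(cu, cw, h, m) (u, w, s, r, i) _. ((cu, w, h \<or> cw \<and> u, m), (u, cw, s, r, i))))
      ((cu, w = 0, False, m), data (\<lambda>x. x = k) (\<lambda>x. Suc x = w) S R I, w * n) =
     ((cu, False, w = k, m), data (\<lambda>x. x = k) (\<lambda>x. x = w) S R I, w * n)"
    by (rule run_Pass[where M = "\<lambda>i. (cu, i = w, w = k \<and> k < i, m)"]) (use assms in auto)
  have 2: "run (Pass True (\<lambda>(cu, cw, h, m) (u, w, s, r, i) b. ((cu, cw, h, m), (u, w, if h then b else s, r, i))))
     ((cu, False, w = k, m), data (\<lambda>x. x = k) (\<lambda>x. x = w) S R I, w * n) =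
     ((cu, False, w = k, m), data (\<lambda>x. x = k) (\<lambda>x. x = w)
       (if w = k then {v. adj G (vs ! k) v} else S) R I, Suc w * n)"
    by (rule run_Pass) (use assms inp[OF assms(2)] in auto)
  show ?thesis
    using 1 2 unfolding load_row_def m by (simp del: hexec.simps(2))
qed

text \<open>Candidates from \<open>A\<close> are tried in the order of \<open>vs\<close>. The start
  set \<open>I\<close> allows a second sweep to extend the outcome of a first one.\<close>

primrec greedy :: "'a set \<Rightarrow> 'a set \<Rightarrow> nat \<Rightarrow> 'a set" where
  "greedy A I 0 = I"
| "greedy A I (Suc w) =
    (if vs ! w \<in> A \<and> \<not> (\<exists>y\<in>greedy A I w. adj G (vs ! w) y) then insert (vs ! w) (greedy A I w)
     else greedy A I w)"

lemma run_try_row: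
  assumes "w < n" "I \<subseteq> vertices G"
    and A: "\<And>v. v \<in> vertices G \<Longrightarrow> v \<in> A \<longleftrightarrow> a \<and> sel (v \<in> S) (v \<in> R)"
  shows "run (try_row sel) ((cu, w = 0, h, a, m), data U (\<lambda>x. Suc x = w) S R I, w * n) =
    ((cu, False, \<exists>y\<in>I. adj G (vs ! w) y, a, m), data U (\<lambda>x. x = w) S R
       (if vs ! w \<in> A \<and> \<not> (\<exists>y\<in>I. adj G (vs ! w) y) then insert (vs ! w) I else I), Suc w * n)"
proof -
  obtain t1 t2 z where m: "m = (t1, t2, z)" by (cases m)
  define h' where "h' = (\<exists>y\<in>I. adj G (vs ! w) y)"
  have h': "h' \<longleftrightarrow> (\<exists>x<n. vs ! x \<in> I \<and> adj G (vs ! w) (vs ! x))"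
    unfolding h'_def using ex_vertex[of "\<lambda>y. y \<in> I \<and> adj G (vs ! w) y"] assms(2) by blast
  have 1: "run (Pass True (\<lambda>(cu, cw, h, m) (u, w, s, r, i) b. ((cu, w, h \<or> i \<and> b, m), (u, cw, s, r, i))))
      ((cu, w = 0, False, a, m), data U (\<lambda>x. Suc x = w) S R I, w * n) =
     ((cu, False, h', a, m), data U (\<lambda>x. x = w) S R I, Suc w * n)"
    by (rule run_Pass[where M = "\<lambda>i. (cu, i = w, \<exists>x<i. vs ! x \<in> I \<and> adj G (vs ! w) (vs ! x), a, m)"])
      (use assms(1) inp[OF assms(1)] h' in \<open>auto simp: less_Suc_eq\<close>)
  have 2: "run (Pass False (\<lambda>(cu, cw, h, a, m) (u, w, s, r, i) b.
       ((cu, cw, h, a, m), (u, w, s, r, i \<or> w \<and> sel s r \<and> \<not> h \<and> a))))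
     ((cu, False, h', a, m), data U (\<lambda>x. x = w) S R I, Suc w * n) =
     ((cu, False, h', a, m), data U (\<lambda>x. x = w) S R
       (if vs ! w \<in> A \<and> \<not> h' then insert (vs ! w) I else I), Suc w * n)"
    by (rule run_Pass) (use A[of "vs ! w"] nth_vertex[OF assms(1)] assms(1) in \<open>auto simp: vertex_eq\<close>)
  show ?thesis
    using 1 2 unfolding try_row_def m h'_def[symmetric] by (simp del: hexec.simps(2))
qed

lemma greedy_subset: "A \<subseteq> vertices G \<Longrightarrow> I \<subseteq> vertices G \<Longrightarrow> greedy A I w \<subseteq> vertices G"
  by (induction w) auto

lemma run_try_rows:
  assumes "A \<subseteq> vertices G" "I \<subseteq> vertices G"
    and A: "\<And>v. v \<in> vertices G \<Longrightarrow> v \<in> A \<longleftrightarrow> a \<and> sel (v \<in> S) (v \<in> R)"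
  shows "\<exists>cw h' W' p'. run (first_row ;; For (try_row sel)) ((cu, cw0, h, a, m), data U W S R I, p) =
    ((cu, cw, h', a, m), data U W' S R (greedy A I n), p')"
proof -
  obtain t1 t2 z where m: "m = (t1, t2, z)" by (cases m)
  have "\<exists>h'. run (For (try_row sel)) ((cu, True, h, a, m), data U (\<lambda>x. Suc x = 0) S R I, 0) =
    ((cu, n = 0, h', a, m), data U (\<lambda>x. Suc x = n) S R (greedy A I n), n * n)"
  proof (rule hexec_For[where J = "\<lambda>w s. \<exists>h'. s =
      ((cu, w = 0, h', a, m), data U (\<lambda>x. Suc x = w) S R (greedy A I w), w * n)"])
    fix w and s :: "(mem, cell) hstate" assume w: "w < n" and "\<exists>h'. s =
      ((cu, w = 0, h', a, m), data U (\<lambda>x. Suc x = w) S R (greedy A I w), w * n)"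
    then obtain h' where s: "s = ((cu, w = 0, h', a, m), data U (\<lambda>x. Suc x = w) S R (greedy A I w), w * n)"
      by blast
    show "\<exists>h'. run (try_row sel) s =
      ((cu, Suc w = 0, h', a, m), data U (\<lambda>x. Suc x = Suc w) S R (greedy A I (Suc w)), Suc w * n)"
      unfolding s
      using run_try_row[where A = A and a = a and sel = sel and S = S and R = R and cu = cu and h = h' and m = m
          and U = U, OF w greedy_subset[OF assms(1,2)] A]
      by (intro exI[of _ "\<exists>y\<in>greedy A I w. adj G (vs ! w) y"]) (simp del: hexec.simps)
  qed simp
  then show ?thesis using run_first_row[of cu cw0 h a t1 t2 z U W S R I p] by (auto simp: m simp del: hexec.simps(5))
qed

section \<open>Maximal independent sets by greedy choice\<close>

lemma greedy_mono: "v \<le> w \<Longrightarrow> greedy A I v \<subseteq> greedy A I w"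
  by (induction w rule: dec_induct) auto

lemma greedy_Un: "greedy A I w \<subseteq> A \<union> I"
  by (induction w) auto

lemma greedy_independent:
  assumes "\<And>x y. x \<in> I \<Longrightarrow> y \<in> I \<Longrightarrow> \<not> adj G x y" "x \<in> greedy A I w" "y \<in> greedy A I w"
  shows "\<not> adj G x y"
  using assms(2,3)
proof (induction w arbitrary: x y)
  case (Suc w)
  show ?case
    using Suc.prems Suc.IH cograph_irrefl[OF G, of "vs ! w"]
    by (auto simp: insert_commute split: if_splits)
qed (use assms(1) in simp)

text \<open>A candidate is rejected at its turn only because of a neighbour already chosen, and
  choices are never withdrawn.\<close>

lemma greedy_maximal:
  assumes "x \<in> A" "x \<in> vertices G" "x \<notin> greedy A I n"
  shows "\<exists>y\<in>greedy A I n. adj G x y"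
proof -
  obtain w where w: "w < n" "vs ! w = x" using assms(2) vs(2) by (metis in_set_conv_nth)
  have notin: "x \<notin> greedy A I (Suc w)"
    using greedy_mono[OF Suc_leI[OF w(1)], of A I] assms(3) by blast
  have "\<exists>y\<in>greedy A I w. adj G x y"
  proof (rule ccontr)
    assume "\<not> (\<exists>y\<in>greedy A I w. adj G x y)"
    then have "x \<in> greedy A I (Suc w)" using w assms(1) by simp
    then show False using notin by simp
  qed
  then show ?thesis using greedy_mono[OF less_imp_le[OF w(1)], of A I] by blast
qed

text \<open>Peeling off neighbours of the tested vertex first postpones that vertex until they are all gone.\<close>

definition mis :: "'a set \<Rightarrow> 'a set \<Rightarrow> 'a set" where
  "mis S R = greedy R (greedy (S \<inter> R) {} n) n"

lemma mis_subset: "mis S R \<subseteq> R"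
  unfolding mis_def using greedy_Un[of R "greedy (S \<inter> R) {} n" n] greedy_Un[of "S \<inter> R" "{}" n] by blast

lemma mis_independent: "x \<in> mis S R \<Longrightarrow> y \<in> mis S R \<Longrightarrow> \<not> adj G x y"
  unfolding mis_def by (rule greedy_independent[OF greedy_independent[of "{}"]]) auto

lemma mis_maximal: "R \<subseteq> vertices G \<Longrightarrow> x \<in> R \<Longrightarrow> x \<notin> mis S R \<Longrightarrow> \<exists>y\<in>mis S R. adj G x y"
  unfolding mis_def by (rule greedy_maximal) auto

text \<open>If a neighbour of \<open>u\<close> were left in \<open>R\<close>, the first sweep would
  choose at least one such neighbour, and independence would then keep \<open>u\<close> out.\<close>

lemma mis_prefers_neighbours:
  assumes "R \<subseteq> vertices G" "u \<in> mis {v. adj G u v} R" "x \<in> R"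
  shows "\<not> adj G u x"
proof
  assume x: "adj G u x"
  let ?I = "greedy ({v. adj G u v} \<inter> R) {} n"
  have "\<exists>y. y \<in> ?I"
    using greedy_maximal[of x "{v. adj G u v} \<inter> R" "{}"] x assms by blast
  then obtain y where y: "y \<in> ?I" by blast
  then have "adj G u y" using greedy_Un[of "{v. adj G u v} \<inter> R" "{}" n] by blast
  moreover have "y \<in> mis {v. adj G u v} R"
    unfolding mis_def using y greedy_mono[of 0 n R ?I] by auto
  ultimately show False using mis_independent assms(2) by blast
qed

lemma run_peel:
  assumes k: "k < n" and R: "R \<subseteq> vertices G"
  shows "\<exists>cw' h' a' W' p'. run peel ((cu, cw, h, a, m), data (\<lambda>x. x = k) W S R {}, p) =
    ((cu, cw', h', a', m), data (\<lambda>x. x = k) W' S (if vs ! k \<in> R then R - mis S R else R) {}, p')"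
proof -
  obtain t1 t2 z where m: "m = (t1, t2, z)" by (cases m)
  define a' where "a' \<longleftrightarrow> vs ! k \<in> R"
  \<comment> \<open>With \<open>a'\<close> inside the candidate sets, one run of the program covers
    both cases: if the tested vertex is gone, both sweeps have no candidates.\<close>
  define I where "I = greedy {v. a' \<and> v \<in> S \<and> v \<in> R} {} n"
  define J where "J = greedy {v. a' \<and> v \<in> R} I n"
  have I: "I \<subseteq> vertices G" unfolding I_def by (rule greedy_subset) (use R in auto)
  have 1: "run (Pass False (\<lambda>(cu, cw, h, a, m) (u, w, s, r, i) _. ((cu, cw, h, a \<or> u \<and> r, m), (u, w, s, r, i))))
      ((cu, cw, h, False, m), data (\<lambda>x. x = k) W S R {}, p) =
      ((cu, cw, h, a', m), data (\<lambda>x. x = k) W S R {}, p)"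
    by (rule run_Pass[where M = "\<lambda>i. (cu, cw, h, k < i \<and> a', m)"]) (use k in \<open>auto simp: a'_def less_Suc_eq\<close>)
  obtain cw1 h1 W1 p1 where 2: "run (first_row ;; For (try_row (\<and>)))
      ((cu, cw, h, a', m), data (\<lambda>x. x = k) W S R {}, p) =
      ((cu, cw1, h1, a', m), data (\<lambda>x. x = k) W1 S R I, p1)"
    using run_try_rows[of "{v. a' \<and> v \<in> S \<and> v \<in> R}" "{}" a' "(\<and>)" S R cu cw h m "\<lambda>x. x = k" W p] R
    unfolding I_def by blast
  obtain cw2 h2 W2 p2 where 3: "run (first_row ;; For (try_row (\<lambda>s r. r)))
      ((cu, cw1, h1, a', m), data (\<lambda>x. x = k) W1 S R I, p1) =
      ((cu, cw2, h2, a', m), data (\<lambda>x. x = k) W2 S R J, p2)"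
    using run_try_rows[of "{v. a' \<and> v \<in> R}" I a' "\<lambda>s r. r" S R cu cw1 h1 m "\<lambda>x. x = k" W1 p1] R I
    unfolding J_def by blast
  have J: "R - J = (if vs ! k \<in> R then R - mis S R else R)"
  proof (cases a')
    case True
    then have "J = mis S R" by (simp add: J_def I_def mis_def Int_def)
    then show ?thesis using True by (simp add: a'_def)
  next
    case False
    have "J = {}" using False greedy_Un[of "{}" "{}"] by (auto simp: J_def I_def)
    then show ?thesis using False by (simp add: a'_def)
  qed
  have 4: "run (Pass False (\<lambda>m (u, w, s, r, i) _. (m, (u, w, s, r \<and> \<not> i, False))))
      ((cu, cw2, h2, a', m), data (\<lambda>x. x = k) W2 S R J, p2) =
      ((cu, cw2, h2, a', m), data (\<lambda>x. x = k) W2 S (R - J) {}, p2)"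
    by (rule run_Pass) auto
  have "run peel ((cu, cw, h, a, m), data (\<lambda>x. x = k) W S R {}, p) =
     ((cu, cw2, h2, a', m), data (\<lambda>x. x = k) W2 S (R - J) {}, p2)"
    using 1 2 3 4 unfolding peel_def by (simp add: m del: hexec.simps(2,5))
  then show ?thesis unfolding J by blast
qed

definition twin :: "'a set \<Rightarrow> nat \<Rightarrow> bool" where
  "twin S i \<longleftrightarrow> (\<forall>x\<in>vertices G. adj G (vs ! i) x = (x \<in> S))"

lemma run_compare_row:
  assumes "w < n"
  shows "run compare_row ((cu, cw, h, a, t1, t2, z), data U W S R I, w * n) =
    ((cu, cw, \<not> twin S w, a, t1 \<or> twin S w, t2 \<or> t1 \<and> twin S w, z), data U W S R I, Suc w * n)"
proof -
  have h: "\<not> twin S w \<longleftrightarrow> (\<exists>x<n. adj G (vs ! w) (vs ! x) \<noteq> (vs ! x \<in> S))"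
    unfolding twin_def using ex_vertex[of "\<lambda>x. adj G (vs ! w) x \<noteq> (x \<in> S)"] by blast
  have "run (Pass True (\<lambda>(cu, cw, h, m) (u, w, s, r, i) b. ((cu, cw, h \<or> b \<noteq> s, m), (u, w, s, r, i))))
     ((cu, cw, False, a, t1, t2, z), data U W S R I, w * n) =
     ((cu, cw, \<not> twin S w, a, t1, t2, z), data U W S R I, Suc w * n)"
    unfolding h
    by (rule run_Pass[where M = "\<lambda>i. (cu, cw, \<exists>x<i. adj G (vs ! w) (vs ! x) \<noteq> (vs ! x \<in> S), a, t1, t2, z)"])
      (use assms inp[OF assms] in \<open>auto simp: less_Suc_eq\<close>)
  then show ?thesis unfolding compare_row_def by (simp del: hexec.simps(2))
qed

definition remaining :: "nat \<Rightarrow> nat \<Rightarrow> 'a set" where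
  "remaining k t = ((\<lambda>R. if vs ! k \<in> R then R - mis {v. adj G (vs ! k) v} R else R) ^^ t) (vertices G)"

definition frozen :: "nat \<Rightarrow> bool" where
  "frozen k \<longleftrightarrow> (\<exists>i<n. \<exists>j<i. twin {v. adj G (vs ! k) v} i \<and> twin {v. adj G (vs ! k) v} j) \<and>
     remaining k n = {}"

lemma remaining_subset: "remaining k t \<subseteq> vertices G"
  by (induction t) (auto simp: remaining_def)

lemma run_load_rows:
  assumes k: "k < n"
  shows "\<exists>cw' h' W' p'. run (first_row ;; For load_row) ((cu, cw, h, m), data (\<lambda>x. x = k) W {} R I, p) =
    ((cu, cw', h', m), data (\<lambda>x. x = k) W' {v. adj G (vs ! k) v} R I, p')"
proof -
  obtain a t1 t2 z where m: "m = (a, t1, t2, z)" by (cases m)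
  let ?S = "\<lambda>w. if k < w then {v. adj G (vs ! k) v} else {}"
  have "\<exists>h'. run (For load_row) ((cu, True, h, m), data (\<lambda>x. x = k) (\<lambda>x. Suc x = 0) {} R I, 0) =
    ((cu, n = 0, h', m), data (\<lambda>x. x = k) (\<lambda>x. Suc x = n) (?S n) R I, n * n)"
  proof (rule hexec_For[where J = "\<lambda>w s. \<exists>h'. s =
      ((cu, w = 0, h', m), data (\<lambda>x. x = k) (\<lambda>x. Suc x = w) (?S w) R I, w * n)"])
    fix w and s :: "(mem, cell) hstate"
    assume w: "w < n" and "\<exists>h'. s = ((cu, w = 0, h', m), data (\<lambda>x. x = k) (\<lambda>x. Suc x = w) (?S w) R I, w * n)"
    then obtain h' where s: "s = ((cu, w = 0, h', m), data (\<lambda>x. x = k) (\<lambda>x. Suc x = w) (?S w) R I, w * n)"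
      by blast
    have S: "(if w = k then {v. adj G (vs ! k) v} else ?S w) = ?S (Suc w)" by auto
    show "\<exists>h'. run load_row s =
        ((cu, Suc w = 0, h', m), data (\<lambda>x. x = k) (\<lambda>x. Suc x = Suc w) (?S (Suc w)) R I, Suc w * n)"
      unfolding s using run_load_row[OF k w, of cu h' m "?S w" R I] unfolding S
      by (intro exI[of _ "w = k"]) (simp del: hexec.simps)
  qed simp
  then show ?thesis
    using run_first_row[of cu cw h a "fst (snd m)" "fst (snd (snd m))" "snd (snd (snd m))" "\<lambda>x. x = k" W "{}" R I p] k
    by (auto simp: m simp del: hexec.simps(5))
qed

lemma run_peels:
  assumes k: "k < n"
  shows "\<exists>cw' h' a' W' p'. run (For peel)
      ((cu, cw, h, a, m), data (\<lambda>x. x = k) W {v. adj G (vs ! k) v} (vertices G) {}, p) =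
    ((cu, cw', h', a', m), data (\<lambda>x. x = k) W' {v. adj G (vs ! k) v} (remaining k n) {}, p')"
proof (rule hexec_For[where J = "\<lambda>t s. \<exists>cw' h' a' W' p'. s =
      ((cu, cw', h', a', m), data (\<lambda>x. x = k) W' {v. adj G (vs ! k) v} (remaining k t) {}, p')"])
  fix t and s :: "(mem, cell) hstate"
  assume "\<exists>cw' h' a' W' p'. s =
      ((cu, cw', h', a', m), data (\<lambda>x. x = k) W' {v. adj G (vs ! k) v} (remaining k t) {}, p')"
  then obtain cw' h' a' W' p' where s: "s =
      ((cu, cw', h', a', m), data (\<lambda>x. x = k) W' {v. adj G (vs ! k) v} (remaining k t) {}, p')" by blast
  have Suc: "remaining k (Suc t) = (if vs ! k \<in> remaining k t
      then remaining k t - mis {v. adj G (vs ! k) v} (remaining k t) else remaining k t)"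
    by (simp add: remaining_def)
  show "\<exists>cw' h' a' W' p'. run peel s =
      ((cu, cw', h', a', m), data (\<lambda>x. x = k) W' {v. adj G (vs ! k) v} (remaining k (Suc t)) {}, p')"
    unfolding s Suc by (rule run_peel[OF k remaining_subset])
next
  show "\<exists>cw' h' a' W' p'. ((cu, cw, h, a, m), data (\<lambda>x. x = k) W {v. adj G (vs ! k) v} (vertices G) {}, p) =
      ((cu, cw', h', a', m), data (\<lambda>x. x = k) W' {v. adj G (vs ! k) v} (remaining k 0) {}, p')"
    by (auto simp: remaining_def)
qed

lemma run_compare_rows:
  "\<exists>cw' h' W' p'. run (first_row ;; For compare_row) ((cu, cw, h, a, False, False, z), data U W S R I, p) =
    ((cu, cw', h', a, \<exists>i<n. twin S i, \<exists>i<n. \<exists>j<i. twin S i \<and> twin S j, z), data U W' S R I, p')"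
proof -
  have "\<exists>h'. run (For compare_row) ((cu, True, h, a, False, False, z), data U (\<lambda>x. Suc x = 0) S R I, 0) =
    ((cu, True, h', a, \<exists>i<n. twin S i, \<exists>i<n. \<exists>j<i. twin S i \<and> twin S j, z), data U (\<lambda>x. Suc x = 0) S R I, n * n)"
  proof (rule hexec_For[where J = "\<lambda>w s. \<exists>h'. s = ((cu, True, h', a, \<exists>i<w. twin S i,
      \<exists>i<w. \<exists>j<i. twin S i \<and> twin S j, z), data U (\<lambda>x. Suc x = 0) S R I, w * n)"])
    fix w and s :: "(mem, cell) hstate"
    assume w: "w < n" and "\<exists>h'. s = ((cu, True, h', a, \<exists>i<w. twin S i,
      \<exists>i<w. \<exists>j<i. twin S i \<and> twin S j, z), data U (\<lambda>x. Suc x = 0) S R I, w * n)"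
    then obtain h' where s: "s = ((cu, True, h', a, \<exists>i<w. twin S i,
      \<exists>i<w. \<exists>j<i. twin S i \<and> twin S j, z), data U (\<lambda>x. Suc x = 0) S R I, w * n)" by blast
    have t1: "(\<exists>i<Suc w. twin S i) \<longleftrightarrow> (\<exists>i<w. twin S i) \<or> twin S w"
      by (auto simp: less_Suc_eq)
    have t2: "(\<exists>i<Suc w. \<exists>j<i. twin S i \<and> twin S j) \<longleftrightarrow>
        (\<exists>i<w. \<exists>j<i. twin S i \<and> twin S j) \<or> (\<exists>i<w. twin S i) \<and> twin S w"
      by (auto simp: less_Suc_eq)
    show "\<exists>h'. run compare_row s = ((cu, True, h', a, \<exists>i<Suc w. twin S i,
      \<exists>i<Suc w. \<exists>j<i. twin S i \<and> twin S j, z), data U (\<lambda>x. Suc x = 0) S R I, Suc w * n)"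
      unfolding s t1 t2
      using run_compare_row[OF w, of cu True h' a "\<exists>i<w. twin S i" "\<exists>i<w. \<exists>j<i. twin S i \<and> twin S j" z
          U "\<lambda>x. Suc x = 0" S R I]
      by (intro exI[of _ "\<not> twin S w"])
  qed simp
  then show ?thesis
    using run_first_row[of cu cw h a False False z U W S R I p] by (auto simp del: hexec.simps(5))
qed

text \<open>Only the mark \<open>u\<close> with its carry and the result \<open>z\<close> pass from
  one vertex to the next. Everything else may be arbitrary, because it is reset before it is
  used.\<close>

lemma run_test_vertex:
  assumes k: "k < n"
  shows "\<exists>cw' h' a' t1' t2' W' S' R' I' p'. run test_vertex
      ((k = 0, cw, h, a, t1, t2, z), data (\<lambda>x. Suc x = k) W S R I, p) =
    ((Suc k = 0, cw', h', a', t1', t2', z \<or> frozen k), data (\<lambda>x. Suc x = Suc k) W' S' R' I', p')"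
proof -
  let ?N = "{v. adj G (vs ! k) v}"
  note 1 = run_select_vertex[OF k, of cw h a t1 t2 z W S R I p]
  obtain cw1 h1 W1 p1 where 2: "run (first_row ;; For load_row)
      ((False, cw, h, a, False, False, z), data (\<lambda>x. x = k) (\<lambda>_. False) {} (vertices G) {}, p) =
      ((False, cw1, h1, a, False, False, z), data (\<lambda>x. x = k) W1 ?N (vertices G) {}, p1)"
    using run_load_rows[OF k] by blast
  obtain cw2 h2 a2 W2 p2 where 3: "run (For peel)
      ((False, cw1, h1, a, False, False, z), data (\<lambda>x. x = k) W1 ?N (vertices G) {}, p1) =
      ((False, cw2, h2, a2, False, False, z), data (\<lambda>x. x = k) W2 ?N (remaining k n) {}, p2)"
    using run_peels[OF k] by blast
  define b1 b2 where b: "b1 = (\<exists>i<n. twin ?N i)" "b2 = (\<exists>i<n. \<exists>j<i. twin ?N i \<and> twin ?N j)"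
  obtain cw3 h3 W3 p3 where 4: "run (first_row ;; For compare_row)
      ((False, cw2, h2, a2, False, False, z), data (\<lambda>x. x = k) W2 ?N (remaining k n) {}, p2) =
      ((False, cw3, h3, a2, b1, b2, z), data (\<lambda>x. x = k) W3 ?N (remaining k n) {}, p3)"
    unfolding b using run_compare_rows by blast
  have ne: "remaining k n \<noteq> {} \<longleftrightarrow> (\<exists>x<n. vs ! x \<in> remaining k n)"
    using ex_vertex[of "\<lambda>v. v \<in> remaining k n"] remaining_subset[of k n] by blast
  have 5: "run (Pass False (\<lambda>(cu, cw, h, a, m) (u, w, s, r, i) _. ((cu, cw, h, a \<or> r, m), (u, w, s, r, i))))
      ((False, cw3, h3, False, b1, b2, z), data (\<lambda>x. x = k) W3 ?N (remaining k n) {}, p3) =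
      ((False, cw3, h3, remaining k n \<noteq> {}, b1, b2, z), data (\<lambda>x. x = k) W3 ?N (remaining k n) {}, p3)"
    unfolding ne
    by (rule run_Pass[where M = "\<lambda>i. (False, cw3, h3, \<exists>x<i. vs ! x \<in> remaining k n, b1, b2, z)"])
      (auto simp: less_Suc_eq)
  have "run test_vertex ((k = 0, cw, h, a, t1, t2, z), data (\<lambda>x. Suc x = k) W S R I, p) =
    ((False, cw3, h3, remaining k n \<noteq> {}, b1, b2, z \<or> frozen k), data (\<lambda>x. x = k) W3 ?N (remaining k n) {}, p3)"
    using 1 2 3 4 5 unfolding test_vertex_def by (simp add: frozen_def b(2) del: hexec.simps(2,5))
  then show ?thesis by auto
qed

lemma run_test_vertices:
  "\<exists>cw h a t1 t2 s. run (For test_vertex)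
      ((True, False, False, False, False, False, False), \<lambda>_. (False, False, False, False, False), 0) =
    ((n = 0, cw, h, a, t1, t2, \<exists>k<n. frozen k), s)"
proof -
  define J where "J k s \<longleftrightarrow> (\<exists>cw h a t1 t2 W S R I p. s =
      ((k = 0, cw, h, a, t1, t2, \<exists>i<k. frozen i), data (\<lambda>x. Suc x = k) W S R I, p))" for k and s :: "(mem, cell) hstate"
  have "J n (run (For test_vertex)
      ((True, False, False, False, False, False, False), \<lambda>_. (False, False, False, False, False), 0))"
  proof (rule hexec_For[where J = J])
    have "(\<lambda>_. (False, False, False, False, False)) = data (\<lambda>x. Suc x = 0) (\<lambda>_. False) {} {} {}"
      by (auto simp: data_def cells_def fun_eq_iff)
    then show "J 0 ((True, False, False, False, False, False, False), \<lambda>_. (False, False, False, False, False), 0)"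
      unfolding J_def by auto
    fix k and s :: "(mem, cell) hstate" assume k: "k < n" and "J k s"
    then obtain cw h a t1 t2 W S R I p where s: "s =
      ((k = 0, cw, h, a, t1, t2, \<exists>i<k. frozen i), data (\<lambda>x. Suc x = k) W S R I, p)"
      unfolding J_def by blast
    have "(\<exists>i<Suc k. frozen i) \<longleftrightarrow> (\<exists>i<k. frozen i) \<or> frozen k"
      by (auto simp: less_Suc_eq)
    then show "J (Suc k) (run test_vertex s)"
      unfolding J_def s
      using run_test_vertex[OF k, of cw h a t1 t2 "\<exists>i<k. frozen i" W S R I p] by (simp only:)
  qed
  then show ?thesis unfolding J_def by blast
qed

lemma ex_frozen_iff: "(\<exists>k<n. frozen k) \<longleftrightarrow> \<not> chi_unfrozen G"
proof -
  have card: "card (vertices G) = n" using vs by (metis distinct_card)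
  have peeled: "remaining k n = {} \<longleftrightarrow>
      (\<exists>K. clique G K \<and> vs ! k \<in> K \<and> (\<forall>L. clique G L \<longrightarrow> card L \<le> card K))" if "k < n" for k
    unfolding remaining_def card[symmetric]
    by (rule peeling_decides_max_clique[OF G nth_vertex[OF that]])
      (use mis_subset mis_independent mis_maximal mis_prefers_neighbours in blast)+
  have twin: "twin {v. adj G (vs ! k) v} i \<longleftrightarrow> (\<forall>x. adj G (vs ! k) x \<longleftrightarrow> adj G (vs ! i) x)" for k i
    using cograph_edge_subset[OF G] unfolding twin_def mem_Collect_eq by blast
  have two: "(\<exists>i<n. \<exists>j<i. twin {v. adj G (vs ! k) v} i \<and> twin {v. adj G (vs ! k) v} j) \<longleftrightarrow>
      (\<exists>v\<in>vertices G. vs ! k \<noteq> v \<and> (\<forall>x. adj G (vs ! k) x \<longleftrightarrow> adj G v x))" if k: "k < n" for k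
  proof
    assume "\<exists>i<n. \<exists>j<i. twin {v. adj G (vs ! k) v} i \<and> twin {v. adj G (vs ! k) v} j"
    then obtain i j where ij: "i < n" "j < i" "twin {v. adj G (vs ! k) v} i" "twin {v. adj G (vs ! k) v} j"
      by blast
    \<comment> \<open>At most one of two agreeing rows is row \<open>k\<close> itself; the other one
      provides the twin.\<close>
    define l where "l = (if i = k then j else i)"
    have l: "l < n" "l \<noteq> k" "twin {v. adj G (vs ! k) v} l" using ij by (auto simp: l_def)
    then show "\<exists>v\<in>vertices G. vs ! k \<noteq> v \<and> (\<forall>x. adj G (vs ! k) x \<longleftrightarrow> adj G v x)"
      using vertex_eq[OF k l(1)] nth_vertex[OF l(1)] unfolding twin by blast
  next
    assume "\<exists>v\<in>vertices G. vs ! k \<noteq> v \<and> (\<forall>x. adj G (vs ! k) x \<longleftrightarrow> adj G v x)"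
    then obtain l where l: "l < n" "vs ! k \<noteq> vs ! l" "twin {v. adj G (vs ! k) v} l"
      unfolding ex_vertex[symmetric] twin by blast
    moreover have "twin {v. adj G (vs ! k) v} k" unfolding twin by simp
    moreover have "l < k \<or> k < l" using l(2) by (metis linorder_neqE_nat)
    ultimately show "\<exists>i<n. \<exists>j<i. twin {v. adj G (vs ! k) v} i \<and> twin {v. adj G (vs ! k) v} j"
      using k by blast
  qed
  define crit where "crit u \<longleftrightarrow> (\<exists>K. clique G K \<and> u \<in> K \<and> (\<forall>L. clique G L \<longrightarrow> card L \<le> card K))" for u
  define tw where "tw u v \<longleftrightarrow> (\<forall>x. adj G u x \<longleftrightarrow> adj G v x)" for u v
  have "frozen k \<longleftrightarrow> (\<exists>v\<in>vertices G. vs ! k \<noteq> v \<and> tw (vs ! k) v) \<and> crit (vs ! k)" if "k < n" for k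
    unfolding frozen_def two[OF that] peeled[OF that] crit_def tw_def ..
  then have "(\<exists>k<n. frozen k) \<longleftrightarrow>
      (\<exists>k<n. (\<exists>v\<in>vertices G. vs ! k \<noteq> v \<and> tw (vs ! k) v) \<and> crit (vs ! k))" by blast
  also have "\<dots> \<longleftrightarrow> (\<exists>u\<in>vertices G. (\<exists>v\<in>vertices G. u \<noteq> v \<and> tw u v) \<and> crit u)"
    by (rule ex_vertex)
  also have "\<dots> \<longleftrightarrow> \<not> chi_unfrozen G"
    unfolding chi_unfrozen_iff[OF G] crit_def tw_def by blast
  finally show ?thesis .
qed

end

section \<open>Reading the matrix off the encoding\<close>

lemma length_concat_matrix: "length (concat (map (\<lambda>u. map (f u) vs) us)) = length us * length vs"
  by (induction us) auto

lemma nth_concat_matrix: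
  "i < length us \<Longrightarrow> j < length vs \<Longrightarrow>
    concat (map (\<lambda>u. map (f u) vs) us) ! (i * length vs + j) = f (us ! i) (vs ! j)"
proof (induction us arbitrary: i)
  case (Cons u us)
  show ?case
  proof (cases i)
    case 0
    then show ?thesis using Cons.prems by (simp add: nth_append)
  next
    case (Suc i')
    then show ?thesis using Cons.IH[of i'] Cons.prems by (simp add: nth_append)
  qed
qed simp

lemma takeWhile_encode_graph: "length (takeWhile id (encode_graph vs G)) = length vs"
  by (simp add: encode_graph_def takeWhile_append)

lemma nth_encode_graph:
  assumes "i < length vs" "j < length vs"
  shows "length vs + 1 + (i * length vs + j) < length (encode_graph vs G)"
    and "encode_graph vs G ! (length vs + 1 + (i * length vs + j)) \<longleftrightarrow> adj G (vs ! i) (vs ! j)"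
proof -
  have "i * length vs + j < Suc i * length vs" using assms by simp
  also have "\<dots> \<le> length vs * length vs" using assms by (intro mult_right_mono) auto
  finally show "length vs + 1 + (i * length vs + j) < length (encode_graph vs G)"
    by (simp add: encode_graph_def length_concat_matrix)
  show "encode_graph vs G ! (length vs + 1 + (i * length vs + j)) \<longleftrightarrow> adj G (vs ! i) (vs ! j)"
    using nth_concat_matrix[OF assms, of "adj G"] by (simp add: encode_graph_def nth_append)
qed

theorem theorem21: "in_P_for chi_Unfrozenness {G. cograph G}"
proof -
  \<comment> \<open>Only \<open>cu\<close> is set in the initial memory, so that the first shift
    marks cell 0 as the tested vertex. \<open>z\<close> reports that some nonedge raises the
    chromatic number; hence acceptance is its negation.\<close>
  obtain M where M: "wf_tm M" "polynomial_time M" "\<And>x. accepts M x \<longleftrightarrow>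
     (case fst (hexec (length (takeWhile id x))
       (\<lambda>i. length (takeWhile id x) + 1 + i < length x \<and> x ! (length (takeWhile id x) + 1 + i))
       (For test_vertex)
       ((True, False, False, False, False, False, False), \<lambda>_. (False, False, False, False, False), 0)) of
      (cu, cw, h, a, t1, t2, z) \<Rightarrow> \<not> z)"
    using hl_polynomial_time[of "\<lambda>(cu, cw, h, a, t1, t2, z). \<not> z" "For test_vertex"
        "(True, False, False, False, False, False, False)" "(False, False, False, False, False)"] by blast
  have "accepts M (encode_graph vs G) \<longleftrightarrow> G \<in> chi_Unfrozenness"
    if G: "cograph G" and vs: "distinct vs" "set vs = vertices G" for G :: "nat graph" and vs
  proof -
    let ?inp = "\<lambda>i. length vs + 1 + i < length (encode_graph vs G) \<and> encode_graph vs G ! (length vs + 1 + i)"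
    have inp: "?inp (w * length vs + x) \<longleftrightarrow> adj G (vs ! w) (vs ! x)"
      if "w < length vs" "x < length vs" for w x
      using nth_encode_graph[OF that] by blast
    obtain cu cw h a t1 t2 s where "hexec (length vs) ?inp (For test_vertex)
       ((True, False, False, False, False, False, False), \<lambda>_. (False, False, False, False, False), 0) =
      ((cu, cw, h, a, t1, t2, \<exists>k<length vs. frozen G vs k), s)"
      using run_test_vertices[OF G vs, of ?inp, OF inp] by blast
    then have "accepts M (encode_graph vs G) \<longleftrightarrow> \<not> (\<exists>k<length vs. frozen G vs k)"
      unfolding M(3) takeWhile_encode_graph by simp
    also have "\<dots> \<longleftrightarrow> G \<in> chi_Unfrozenness"
      using ex_frozen_iff[OF G vs, of ?inp, OF inp] cograph_simple_graph[OF G]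
      by (simp add: chi_Unfrozenness_def)
    finally show ?thesis .
  qed
  then show ?thesis unfolding in_P_for_def using M(1,2) by auto
qed

end
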